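(* Let $n\ge1$, let $p_1,\dots,p_n\in(0,1)$, and let $Q_1,\dots,Q_n$ be probability distributions on $\mathbb{N}=\{1,2,\ldots\}$ with finite means and with full support on $\mathbb{N}$ (i.e. $Q_i(y)>0$ for all $y\ge1$). Let $S_n=\sum_{i=1}^n Y_i$ with $Y_i=B_iX_i$, where $X_1,\dots,X_n,B_1,\dots,B_n$ are mutually independent, $X_i$ has distribution $Q_i$, and $B_i$ is Bernoulli with parameter $p_i$. Let $\lambda=\sum_{i=1}^np_i$, $Q=\sum_{i=1}^n\frac{p_i}{\lambda}Q_i$, and let $P_{S_n}$ be the distribution of $S_n$. Then $$d_{\mathrm{TV}}\big(P_{S_n},\mathrm{CPo}(\lambda,Q)\big)\;\le\;H(\lambda,Q)\left\{\sum_{i=1}^n\left[p_i^3\sum_{y\ge1}Q_i(y)\,y^2\left(\frac{Q_i^{*2}(y)}{2Q_i(y)}-1\right)^2\right]\right\}^{1/2},$$ where $Q_i^{*2}=Q_i*Q_i$ denotes the convolution of $Q_i$ with itself and $H(\lambda,Q)$ is the Stein factor.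
   Context: For $\lambda>0$ and a probability distribution $Q$ on $\mathbb{N}=\{1,2,\ldots\}$, the compound Poisson distribution $\mathrm{CPo}(\lambda,Q)$ is the distribution of $\sum_{i=1}^Z X_i$, where $Z$ is Poisson with parameter $\lambda$ and the $X_i$ are i.i.d. with distribution $Q$, independent of $Z$ (the empty sum is $0$). Total variation distance between distributions on $\mathbb{Z}_+=\{0,1,2,\ldots\}$: $d_{\mathrm{TV}}(P,P')=\frac12\sum_{x\in\mathbb{Z}_+}|P(x)-P'(x)|=\max_{A\subset\mathbb{Z}_+}|P(A)-P'(A)|$. Stein factor $H(\lambda,Q)$: if the sequence $\{jQ(j)\}_{j\ge1}$ is non-increasing, set $\delta=[\lambda\{Q(1)-2Q(2)\}]^{-1}$ (with $\delta=+\infty$ if $Q(1)=2Q(2)$) and let $H(\lambda,Q)=1$ if $\delta\ge1$, $H(\lambda,Q)=\sqrt\delta\,(2-\sqrt\delta)$ if $\delta<1$. Otherwise $H(\lambda,Q)=e^\lambda\min\{1,\frac1{\lambda Q(1)}\}$. The right-hand side of the claimed bound may be $+\infty$, in which case there is nothing to show. *)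

theory Defs
  imports "HOL-Probability.Probability"
begin

text \<open>Distributions on the positive integers are represented as \<^typ>\<open>nat pmf\<close> that give no mass to 0.\<close>

definition compound_poisson :: "real \<Rightarrow> nat pmf \<Rightarrow> nat pmf" where
  "compound_poisson lam Q =
     bind_pmf (poisson_pmf lam) (\<lambda>z. map_pmf sum_list (replicate_pmf z Q))"

definition tv_dist :: "nat measure \<Rightarrow> nat measure \<Rightarrow> real" where
  "tv_dist P P' = 1/2 * (\<Sum>x. \<bar>measure P {x} - measure P' {x}\<bar>)"

definition conv_pmf :: "nat pmf \<Rightarrow> nat pmf \<Rightarrow> nat pmf" where
  "conv_pmf P Q = map_pmf (\<lambda>(x, y). x + y) (pair_pmf P Q)"

text \<open>The mixture \<open>\<Sum>i\<le>n. (p i / \<lambda>) Q i\<close> with \<open>\<lambda> = \<Sum>i\<le>n. p i\<close>; meaningful for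
  non-negative \<open>p i\<close> with positive sum, as lemma \<open>pmf_mixture_pmf\<close> confirms.\<close>

definition mixture_pmf :: "nat \<Rightarrow> (nat \<Rightarrow> real) \<Rightarrow> (nat \<Rightarrow> nat pmf) \<Rightarrow> nat pmf" where
  "mixture_pmf n p Q =
     embed_pmf (\<lambda>y. \<Sum>i\<in>{1..n}. p i / (\<Sum>k\<in>{1..n}. p k) * pmf (Q i) y)"

lemma pmf_mixture_pmf:
  assumes nonneg: "\<And>i. i \<in> {1..n} \<Longrightarrow> 0 \<le> p i" and pos: "0 < (\<Sum>k\<in>{1..n}. p k)"
  shows "pmf (mixture_pmf n p Q) y = (\<Sum>i\<in>{1..n}. p i / (\<Sum>k\<in>{1..n}. p k) * pmf (Q i) y)"
  unfolding mixture_pmf_def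
proof (rule pmf_embed_pmf)
  let ?w = "\<lambda>i. p i / (\<Sum>k\<in>{1..n}. p k)"
  have w: "0 \<le> ?w i" if "i \<in> {1..n}" for i
    using nonneg[OF that] pos by simp
  show "0 \<le> (\<Sum>i\<in>{1..n}. ?w i * pmf (Q i) x)" for x
    by (intro sum_nonneg mult_nonneg_nonneg w) auto
  have "(\<integral>\<^sup>+x. ennreal (\<Sum>i\<in>{1..n}. ?w i * pmf (Q i) x) \<partial>count_space UNIV) =
        (\<integral>\<^sup>+x. (\<Sum>i\<in>{1..n}. ennreal (?w i) * ennreal (pmf (Q i) x)) \<partial>count_space UNIV)"
  proof (rule nn_integral_cong)
    fix x
    have "ennreal (\<Sum>i\<in>{1..n}. ?w i * pmf (Q i) x) = (\<Sum>i\<in>{1..n}. ennreal (?w i * pmf (Q i) x))"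
      by (rule sum_ennreal[symmetric]) (intro mult_nonneg_nonneg w, auto)
    also have "\<dots> = (\<Sum>i\<in>{1..n}. ennreal (?w i) * ennreal (pmf (Q i) x))"
      by (intro sum.cong refl ennreal_mult w) auto
    finally show "ennreal (\<Sum>i\<in>{1..n}. ?w i * pmf (Q i) x) = \<dots>" .
  qed
  also have "\<dots> = (\<Sum>i\<in>{1..n}. \<integral>\<^sup>+x. ennreal (?w i) * ennreal (pmf (Q i) x) \<partial>count_space UNIV)"
    by (rule nn_integral_sum) simp
  also have "\<dots> = (\<Sum>i\<in>{1..n}. ennreal (?w i))"
    by (simp add: nn_integral_cmult nn_integral_pmf)
  also have "\<dots> = ennreal (\<Sum>i\<in>{1..n}. ?w i)"
    by (rule sum_ennreal) (rule w)
  also have "(\<Sum>i\<in>{1..n}. ?w i) = 1"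
    using pos by (simp flip: sum_divide_distrib)
  finally show "(\<integral>\<^sup>+x. ennreal (\<Sum>i\<in>{1..n}. ?w i * pmf (Q i) x) \<partial>count_space UNIV) = 1"
    by simp
qed

text \<open>In \<^typ>\<open>ereal\<close>, \<open>1 / 0 = \<infinity>\<close>, as required by the convention for \<open>\<delta>\<close>.\<close>

definition stein_delta :: "real \<Rightarrow> nat pmf \<Rightarrow> ereal" where
  "stein_delta lam Q = 1 / ereal (lam * (pmf Q 1 - 2 * pmf Q 2))"

definition stein_factor :: "real \<Rightarrow> nat pmf \<Rightarrow> real" where
  "stein_factor lam Q =
     (if antimono_on {1..} (\<lambda>j. real j * pmf Q j) then
        if stein_delta lam Q \<ge> 1 then 1
        else let d = real_of_ereal (stein_delta lam Q) in sqrt d * (2 - sqrt d)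
      else exp lam * real_of_ereal (min 1 (1 / ereal (lam * pmf Q 1))))"

definition ennreal_sqrt :: "ennreal \<Rightarrow> ennreal" where
  "ennreal_sqrt x = (if x = \<top> then \<top> else ennreal (sqrt (enn2real x)))"

end

theory Submission
  imports Defs
begin

text \<open>
  Write \<open>F\<close>, \<open>G\<close> for the generating functions of \<open>S\<^sub>n\<close> and of the compound Poisson law, and
  \<open>\<theta> = \<lambda> Q'\<close>, so that \<open>G' = \<theta> G\<close>.  The defect \<open>\<rho> = F' - \<theta> F\<close> measures how far \<open>S\<^sub>n\<close> is from being
  compound Poisson.  Up to sign, its coefficients are \<open>E[Z; S\<^sub>n = k + 1]\<close>, where \<open>Z\<close> is a sum of
  independent centred scores \<open>p\<^sub>i Y\<^sub>i (Q\<^sub>i\<^sup>*\<^sup>2(Y\<^sub>i) / (2 Q\<^sub>i(Y\<^sub>i)) - 1)\<close>, so by Cauchy-Schwarz its \<open>\<ell>\<^sup>1\<close> norm is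
  at most the square root of the variance of \<open>Z\<close>, which is the bracket in the theorem.

  It remains to bound \<open>\<parallel>F - G\<parallel>\<close> by \<open>2 H \<parallel>\<rho>\<parallel>\<close>.  In general one integrates \<open>V' = \<theta> V + \<rho>\<close> for
  \<open>V = F - (F(0) / G(0)) G\<close>; as \<open>\<theta>\<close> has non-negative coefficients this is
  compatible with absolute values.  If \<open>j Q(j)\<close> is non-increasing, \<open>G\<close> is discrete self-decomposable:
  \<open>C\<^sub>s(z) = G(z) / G(s + (1 - s) z)\<close> is again a probability generating function, and it has a Poisson
  factor of mean \<open>s \<lambda> (Q(1) - 2 Q(2))\<close>.  Along the path \<open>F(s + (1 - s) z) C\<^sub>s(z)\<close> from \<open>F\<close> to \<open>G\<close> the
  derivative in \<open>s\<close> is \<open>(1 - z) C\<^sub>s(z) \<rho>(s + (1 - s) z)\<close>, and the norm of \<open>(1 - z) C\<^sub>s(z)\<close> is controlled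
  by that of the Poisson factor.
\<close>

section \<open>Absolutely summable power series\<close>

definition fps_l1 :: "real fps \<Rightarrow> bool" where
  "fps_l1 f \<longleftrightarrow> summable (\<lambda>n. \<bar>fps_nth f n\<bar>)"

definition l1_norm :: "real fps \<Rightarrow> real" where
  "l1_norm f = (\<Sum>n. \<bar>fps_nth f n\<bar>)"

text \<open>Stands for the value at \<open>z = 1\<close>, a boundary point that evaluation inside
  the disc of convergence does not reach.\<close>

definition fps_total :: "real fps \<Rightarrow> real" where
  "fps_total f = (\<Sum>n. fps_nth f n)"

lemma fps_l1_summable: "fps_l1 f \<Longrightarrow> summable (fps_nth f)"
  unfolding fps_l1_def by (rule summable_rabs_cancel)

lemma fps_l1_sums: "fps_l1 f \<Longrightarrow> fps_nth f sums fps_total f"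
  unfolding fps_total_def by (intro summable_sums fps_l1_summable)

lemma l1_norm_sums: "fps_l1 f \<Longrightarrow> (\<lambda>n. \<bar>fps_nth f n\<bar>) sums l1_norm f"
  unfolding l1_norm_def fps_l1_def by (rule summable_sums)

lemma fps_l1_nonneg_sumsI:
  "(\<And>n. 0 \<le> fps_nth f n) \<Longrightarrow> fps_nth f sums c \<Longrightarrow> fps_l1 f"
  by (simp add: fps_l1_def sums_iff)

lemma fps_total_eqI: "fps_nth f sums c \<Longrightarrow> fps_total f = c"
  by (simp add: fps_total_def sums_iff)

lemma l1_norm_nonneg: "fps_l1 f \<Longrightarrow> 0 \<le> l1_norm f"
  unfolding l1_norm_def fps_l1_def by (rule suminf_nonneg) auto

lemma l1_norm_eq_total: "(\<And>n. 0 \<le> fps_nth f n) \<Longrightarrow> l1_norm f = fps_total f"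
  by (simp add: l1_norm_def fps_total_def)

lemma sum_abs_le_l1_norm: "fps_l1 f \<Longrightarrow> finite A \<Longrightarrow> (\<Sum>n\<in>A. \<bar>fps_nth f n\<bar>) \<le> l1_norm f"
  unfolding fps_l1_def l1_norm_def by (rule sum_le_suminf) auto

lemma fps_l1_bounded:
  assumes "\<And>N. (\<Sum>n<N. \<bar>fps_nth f n\<bar>) \<le> c"
  shows "fps_l1 f" "l1_norm f \<le> c"
proof -
  show "fps_l1 f"
    unfolding fps_l1_def
  proof (rule bounded_imp_summable)
    show "(\<Sum>k\<le>n. \<bar>fps_nth f k\<bar>) \<le> c" for n
      using assms[of "Suc n"] unfolding lessThan_Suc_atMost .
  qed auto
  then show "l1_norm f \<le> c"
    unfolding l1_norm_def fps_l1_def using assms by (intro suminf_le_const) auto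
qed

lemma fps_l1_add [intro]:
  assumes "fps_l1 f" "fps_l1 g"
  shows "fps_l1 (f + g)"
  unfolding fps_l1_def
proof (rule summable_comparison_test'[of "\<lambda>n. \<bar>fps_nth f n\<bar> + \<bar>fps_nth g n\<bar>" 0])
  show "summable (\<lambda>n. \<bar>fps_nth f n\<bar> + \<bar>fps_nth g n\<bar>)"
    using assms unfolding fps_l1_def by (rule summable_add)
qed (auto simp: abs_triangle_ineq)

lemma fps_l1_uminus [intro]: "fps_l1 f \<Longrightarrow> fps_l1 (- f)"
  by (simp add: fps_l1_def)

lemma fps_l1_diff [intro]: "fps_l1 f \<Longrightarrow> fps_l1 g \<Longrightarrow> fps_l1 (f - g)"
  using fps_l1_add[of f "- g"] fps_l1_uminus[of g] by simp

lemma fps_total_add: "fps_l1 f \<Longrightarrow> fps_l1 g \<Longrightarrow> fps_total (f + g) = fps_total f + fps_total g"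
  using sums_add[OF fps_l1_sums fps_l1_sums] by (auto intro!: fps_total_eqI simp: sums_def)

lemma fps_total_diff: "fps_l1 f \<Longrightarrow> fps_l1 g \<Longrightarrow> fps_total (f - g) = fps_total f - fps_total g"
  using sums_diff[OF fps_l1_sums fps_l1_sums] by (auto intro!: fps_total_eqI simp: sums_def)

text \<open>The Cauchy product of the two series of absolute values dominates the coefficients of
  \<open>f * g\<close> and sums to the product of the norms.\<close>

lemma fps_l1_mult [intro]: "fps_l1 f \<Longrightarrow> fps_l1 g \<Longrightarrow> fps_l1 (f * g)"
  and l1_norm_mult: "fps_l1 f \<Longrightarrow> fps_l1 g \<Longrightarrow> l1_norm (f * g) \<le> l1_norm f * l1_norm g"
proof -
  assume fg: "fps_l1 f" "fps_l1 g"
  have S: "(\<lambda>k. \<Sum>i\<le>k. \<bar>fps_nth f i\<bar> * \<bar>fps_nth g (k - i)\<bar>) sums (l1_norm f * l1_norm g)"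
    using Cauchy_product_sums[of "\<lambda>n. \<bar>fps_nth f n\<bar>" "\<lambda>n. \<bar>fps_nth g n\<bar>"] fg
    by (simp add: fps_l1_def l1_norm_def)
  have "(\<Sum>n<N. \<bar>fps_nth (f * g) n\<bar>) \<le> l1_norm f * l1_norm g" for N
  proof -
    have "(\<Sum>n<N. \<bar>fps_nth (f * g) n\<bar>) \<le>
        (\<Sum>n<N. \<Sum>i\<le>n. \<bar>fps_nth f i\<bar> * \<bar>fps_nth g (n - i)\<bar>)"
      unfolding fps_mult_nth atLeast0AtMost
      by (intro sum_mono order.trans[OF sum_abs]) (simp add: abs_mult)
    also have "\<dots> \<le> l1_norm f * l1_norm g"
      using sum_le_suminf[of "\<lambda>k. \<Sum>i\<le>k. \<bar>fps_nth f i\<bar> * \<bar>fps_nth g (k - i)\<bar>" "{..<N}"] S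
      by (auto simp: sums_iff sum_nonneg)
    finally show ?thesis .
  qed
  then show "fps_l1 (f * g)" "l1_norm (f * g) \<le> l1_norm f * l1_norm g"
    by (rule fps_l1_bounded)+
qed

lemma fps_total_mult: "fps_l1 f \<Longrightarrow> fps_l1 g \<Longrightarrow> fps_total (f * g) = fps_total f * fps_total g"
  using Cauchy_product_sums[of "fps_nth f" "fps_nth g"]
  by (intro fps_total_eqI) (auto simp: fps_l1_def fps_total_def fps_mult_nth atLeast0AtMost sums_def)

lemma fps_l1_finite: "(\<And>n. n > N \<Longrightarrow> fps_nth f n = 0) \<Longrightarrow> fps_l1 f"
  unfolding fps_l1_def by (rule summable_finite[of "{..N}"]) auto

lemma fps_total_finite: "(\<And>n. n > N \<Longrightarrow> fps_nth f n = 0) \<Longrightarrow> fps_total f = (\<Sum>n\<le>N. fps_nth f n)"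
  unfolding fps_total_def by (rule suminf_finite) auto

lemma fps_l1_const [simp, intro]: "fps_l1 (fps_const c)"
  and fps_total_const [simp]: "fps_total (fps_const c) = c"
  using fps_l1_finite[of 0 "fps_const c"] fps_total_finite[of 0 "fps_const c"] by auto

lemma fps_l1_1 [simp, intro]: "fps_l1 1" and fps_total_1 [simp]: "fps_total 1 = 1"
  using fps_l1_const[of 1] fps_total_const[of 1] by (simp_all del: fps_l1_const fps_total_const)

lemma fps_l1_0 [simp, intro]: "fps_l1 0" and fps_total_0 [simp]: "fps_total 0 = 0"
  using fps_l1_const[of 0] fps_total_const[of 0] by (simp_all del: fps_l1_const fps_total_const)

lemma fps_l1_X [simp, intro]: "fps_l1 fps_X" and fps_total_X [simp]: "fps_total fps_X = 1"
  using fps_l1_finite[of 1 fps_X] fps_total_finite[of 1 fps_X] by auto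

lemma fps_l1_conv_radius: "fps_l1 f \<Longrightarrow> 1 \<le> fps_conv_radius f"
  unfolding fps_conv_radius_def fps_l1_def
  using conv_radius_geI[of "fps_nth f" 1] by (simp add: summable_rabs_cancel one_ereal_def)

lemma fps_mult_nth_nonneg:
  fixes f g :: "real fps"
  assumes "\<And>n. 0 \<le> fps_nth f n" "\<And>n. 0 \<le> fps_nth g n"
  shows "0 \<le> fps_nth (f * g) n"
  unfolding fps_mult_nth by (intro sum_nonneg mult_nonneg_nonneg assms)

text \<open>The differential equation is a recursion that expresses coefficient \<open>m + 1\<close>
  through the earlier ones with non-negative weights. Positivity can thus be read off from the
  logarithmic derivative.\<close>

lemma fps_nth_nonneg_of_deriv:
  fixes f g :: "real fps"
  assumes f: "fps_deriv f = g * f" and g: "\<And>n. 0 \<le> fps_nth g n" and f0: "0 \<le> fps_nth f 0"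
  shows "0 \<le> fps_nth f n"
proof (induction n rule: less_induct)
  case (less n)
  show ?case
  proof (cases n)
    case (Suc m)
    have "real (Suc m) * fps_nth f (Suc m) = fps_nth (g * f) m"
      using f by (metis fps_deriv_nth Suc_eq_plus1)
    also have "\<dots> \<ge> 0"
      unfolding fps_mult_nth using less Suc by (intro sum_nonneg mult_nonneg_nonneg g) auto
    finally show ?thesis using Suc by (simp add: zero_le_mult_iff)
  qed (use f0 in simp)
qed

section \<open>Binomial thinning\<close>

lemma higher_deriv_conv_radius:
  fixes f :: "real fps"
  shows "fps_conv_radius f \<le> fps_conv_radius ((fps_deriv ^^ k) f)"
proof (induction k)
  case (Suc k)
  then show ?case using order.trans[OF Suc fps_conv_radius_deriv] by simp
qed simp

text \<open>The falling factorial is split so that \<open>fact k\<close> cancels in the Taylor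
  coefficients of \<open>thin\<close> and binomial weights remain.\<close>

lemma higher_deriv_nth:
  fixes f :: "real fps"
  shows "fps_nth ((fps_deriv ^^ k) f) n = fact k * real ((n + k) choose k) * fps_nth f (n + k)"
proof (induction k arbitrary: n)
  case (Suc k)
  have "real (Suc n) * real (Suc (n + k) choose k) = real (Suc k) * real (Suc (n + k) choose Suc k)"
    using binomial_absorb_comp[of "Suc (n + k)" k] binomial_absorption[of k "Suc (n + k)"]
    by (simp only: of_nat_mult[symmetric]) (simp add: Suc_diff_le)
  moreover have "fps_nth ((fps_deriv ^^ Suc k) f) n =
      fact k * (real (Suc n) * real (Suc (n + k) choose k)) * fps_nth f (Suc (n + k))"
    by (simp add: Suc)
  ultimately show ?case by (simp only: add_Suc_right fact_Suc of_nat_mult) (simp add: mult_ac)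
qed simp

text \<open>The expansion of \<open>f (s + (1 - s) z)\<close> in powers of \<open>z\<close>, i.e. binomial thinning with survival
  probability \<open>1 - s\<close>.\<close>
definition thin :: "real \<Rightarrow> real fps \<Rightarrow> real fps" where
  "thin s f = Abs_fps (\<lambda>k. (1 - s) ^ k / fact k * eval_fps ((fps_deriv ^^ k) f) s)"

lemma thin_nth: "fps_nth (thin s f) k = (1 - s) ^ k / fact k * eval_fps ((fps_deriv ^^ k) f) s"
  by (simp add: thin_def)

lemma deriv_thin: "fps_deriv (thin s f) = fps_const (1 - s) * thin s (fps_deriv f)"
proof (rule fps_ext)
  fix n
  have d: "(fps_deriv ^^ Suc n) f = (fps_deriv ^^ n) (fps_deriv f)"
    by (simp add: funpow_swap1)
  have "fps_nth (fps_deriv (thin s f)) n =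
      real (Suc n) * ((1 - s) ^ Suc n / fact (Suc n) * eval_fps ((fps_deriv ^^ n) (fps_deriv f)) s)"
    by (simp only: fps_deriv_nth thin_nth d flip: Suc_eq_plus1)
  also have "\<dots> = (1 - s) * ((1 - s) ^ n / fact n * eval_fps ((fps_deriv ^^ n) (fps_deriv f)) s)"
    by (simp only: fact_Suc power_Suc) (simp del: of_nat_Suc)
  finally show "fps_nth (fps_deriv (thin s f)) n = fps_nth (fps_const (1 - s) * thin s (fps_deriv f)) n"
    by (simp add: thin_nth)
qed

lemma thin_zero: "thin s 0 = 0"
proof -
  have "(fps_deriv ^^ k) (0 :: real fps) = 0" for k by (induction k) auto
  then show ?thesis by (intro fps_ext) (simp add: thin_nth)
qed

lemma thin_0: "thin 0 f = f"
  by (rule fps_ext) (simp add: thin_nth eval_fps_at_0 fps_0th_higher_deriv)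

lemma higher_deriv_add: "(fps_deriv ^^ k) (f + g :: real fps) = (fps_deriv ^^ k) f + (fps_deriv ^^ k) g"
  by (induction k) auto

context
  fixes s :: real
  assumes s: "0 \<le> s" "s < 1"
begin

lemma conv_radius_gt: "1 \<le> fps_conv_radius (f :: real fps) \<Longrightarrow> ereal \<bar>s\<bar> < fps_conv_radius f"
  using s by (intro less_le_trans[of "ereal \<bar>s\<bar>" 1 "fps_conv_radius f"]) simp_all

lemma higher_deriv_conv_radius_gt:
  fixes f :: "real fps"
  shows "1 \<le> fps_conv_radius f \<Longrightarrow> ereal \<bar>s\<bar> < fps_conv_radius ((fps_deriv ^^ k) f)"
  using less_le_trans[OF conv_radius_gt[of f] higher_deriv_conv_radius[of f k]] .

lemma thin_add:
  "1 \<le> fps_conv_radius f \<Longrightarrow> 1 \<le> fps_conv_radius g \<Longrightarrow> thin s (f + g) = thin s f + thin s g"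
proof (rule fps_ext)
  fix k assume "1 \<le> fps_conv_radius f" "1 \<le> fps_conv_radius g"
  then have "eval_fps ((fps_deriv ^^ k) f + (fps_deriv ^^ k) g) s =
      eval_fps ((fps_deriv ^^ k) f) s + eval_fps ((fps_deriv ^^ k) g) s"
    using higher_deriv_conv_radius_gt by (intro eval_fps_add) simp_all
  then show "fps_nth (thin s (f + g)) k = fps_nth (thin s f + thin s g) k"
    by (simp add: thin_nth higher_deriv_add ring_distribs add_divide_distrib)
qed

text \<open>Substitution is a ring homomorphism. Through the derivative, the product and chain rules
  reduce coefficient \<open>k + 1\<close> to coefficient \<open>k\<close> of two other products, so
  the induction varies \<open>f\<close> and \<open>g\<close>.\<close>

lemma thin_mult:
  assumes "1 \<le> fps_conv_radius f" "1 \<le> fps_conv_radius g"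
  shows "thin s (f * g) = thin s f * thin s g"
proof (rule fps_ext)
  fix k show "fps_nth (thin s (f * g)) k = fps_nth (thin s f * thin s g) k"
    using assms
  proof (induction k arbitrary: f g)
    case 0
    then show ?case by (simp add: thin_nth eval_fps_mult conv_radius_gt)
  next
    case (Suc k)
    have r: "1 \<le> fps_conv_radius (fps_deriv f)" "1 \<le> fps_conv_radius (fps_deriv g)"
      using Suc.prems fps_conv_radius_deriv order.trans by blast+
    have m: "1 \<le> fps_conv_radius (a * b)"
      if "1 \<le> fps_conv_radius a" "1 \<le> fps_conv_radius b" for a b :: "real fps"
      using that fps_conv_radius_mult[of a b] by (meson min.boundedI order.trans)
    have "real (Suc k) * fps_nth (thin s (f * g)) (Suc k) =
        (1 - s) * fps_nth (thin s (f * fps_deriv g + fps_deriv f * g)) k"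
      using deriv_thin[of s "f * g"] by (metis fps_deriv_nth fps_mult_left_const_nth fps_deriv_mult Suc_eq_plus1)
    also have "\<dots> = fps_nth (fps_deriv (thin s f * thin s g)) k"
      using Suc.prems r
      by (simp add: thin_add m Suc.IH deriv_thin ring_distribs mult_ac flip: fps_mult_left_const_nth)
    also have "\<dots> = real (Suc k) * fps_nth (thin s f * thin s g) (Suc k)"
      by (simp only: fps_deriv_nth Suc_eq_plus1)
    finally show ?case by simp
  qed
qed

text \<open>The weight of \<open>x\<close> is the probability that \<open>k\<close> out of
  \<open>x\<close> individuals survive, each with probability \<open>1 - s\<close>.\<close>

lemma thin_nth_sums:
  assumes "1 \<le> fps_conv_radius f"
  shows "(\<lambda>x. fps_nth f x * (real (x choose k) * (1 - s) ^ k * s ^ (x - k))) sums fps_nth (thin s f) k"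
proof -
  have "(\<lambda>x. (1 - s) ^ k / fact k * (fps_nth ((fps_deriv ^^ k) f) x * s ^ x)) sums fps_nth (thin s f) k"
    unfolding thin_nth
    using higher_deriv_conv_radius_gt[OF assms] by (intro sums_mult sums_eval_fps) simp
  then have "(\<lambda>x. fps_nth f (x + k) * (real ((x + k) choose k) * (1 - s) ^ k * s ^ (x + k - k)))
      sums fps_nth (thin s f) k"
    by (simp add: higher_deriv_nth mult_ac)
  \<comment> \<open>Terms with \<open>x < k\<close> carry a binomial coefficient 0, so the sum may
    start at \<open>k\<close>.\<close>
  then show ?thesis
    by (subst (asm) sums_zero_iff_shift) auto
qed

lemma sum_binomial_le_1: "(\<Sum>k<N. real (x choose k) * (1 - s) ^ k * s ^ (x - k)) \<le> 1"
proof -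
  have "(\<Sum>k<N. real (x choose k) * (1 - s) ^ k * s ^ (x - k)) \<le>
      (\<Sum>k<N + Suc x. real (x choose k) * (1 - s) ^ k * s ^ (x - k))"
    using s by (intro sum_mono2) auto
  also have "\<dots> = (\<Sum>k\<le>x. real (x choose k) * (1 - s) ^ k * s ^ (x - k))"
    using s by (intro sum.mono_neutral_right) auto
  also have "\<dots> = 1"
    using binomial_ring[of "1 - s" s x] by simp
  finally show ?thesis .
qed

text \<open>Thinning redistributes each coefficient with non-negative weights of sum at most 1. The
  thinned series \<open>a\<close> of absolute values dominates the signed one and supplies its
  absolute convergence.\<close>

lemma fps_l1_thin: "fps_l1 f \<Longrightarrow> fps_l1 (thin s f)"
  and l1_norm_thin: "fps_l1 f \<Longrightarrow> l1_norm (thin s f) \<le> l1_norm f"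
proof -
  assume f: "fps_l1 f"
  define b where "b x k = real (x choose k) * (1 - s) ^ k * s ^ (x - k)" for x k
  have b0: "0 \<le> b x k" for x k using s by (simp add: b_def)
  define a where "a = Abs_fps (\<lambda>n. \<bar>fps_nth f n\<bar>)"
  have a: "fps_l1 a" using f by (simp add: a_def fps_l1_def)
  have S: "(\<lambda>x. \<bar>fps_nth f x\<bar> * b x k) sums fps_nth (thin s a) k" for k
    using thin_nth_sums[OF fps_l1_conv_radius[OF a], of k] by (simp add: a_def b_def)
  have le: "\<bar>fps_nth (thin s f) k\<bar> \<le> fps_nth (thin s a) k" for k
  proof -
    have T: "(\<lambda>x. fps_nth f x * b x k) sums fps_nth (thin s f) k"
      using thin_nth_sums[OF fps_l1_conv_radius[OF f], of k] by (simp add: b_def)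
    have "\<bar>\<Sum>x. fps_nth f x * b x k\<bar> \<le> (\<Sum>x. \<bar>fps_nth f x * b x k\<bar>)"
      using S[of k] b0 by (intro summable_rabs) (simp add: abs_mult sums_iff)
    then show ?thesis using S[of k] T b0 by (simp add: abs_mult sums_iff)
  qed
  have "(\<Sum>k<N. \<bar>fps_nth (thin s f) k\<bar>) \<le> l1_norm f" for N
  proof -
    have "(\<Sum>k<N. \<bar>fps_nth (thin s f) k\<bar>) \<le> (\<Sum>k<N. fps_nth (thin s a) k)"
      by (intro sum_mono le)
    also have "\<dots> \<le> l1_norm f"
    proof (rule sums_le)
      show "(\<lambda>x. \<Sum>k<N. \<bar>fps_nth f x\<bar> * b x k) sums (\<Sum>k<N. fps_nth (thin s a) k)"
        by (intro sums_sum S)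
      show "(\<lambda>x. \<bar>fps_nth f x\<bar>) sums l1_norm f" by (rule l1_norm_sums[OF f])
      show "(\<Sum>k<N. \<bar>fps_nth f x\<bar> * b x k) \<le> \<bar>fps_nth f x\<bar>" for x
        using mult_left_mono[OF sum_binomial_le_1[of x N], of "\<bar>fps_nth f x\<bar>"]
        by (simp add: sum_distrib_left b_def)
    qed
    finally show ?thesis .
  qed
  then show "fps_l1 (thin s f)" "l1_norm (thin s f) \<le> l1_norm f"
    by (rule fps_l1_bounded)+
qed

text \<open>The substitution fixes \<open>z = 1\<close>. Tannery's theorem interchanges the sums:
  for \<open>N > x\<close> the binomial weights of \<open>x\<close> already sum to 1, and the terms
  are dominated by the absolute coefficients.\<close>

lemma fps_total_thin:
  assumes f: "fps_l1 f"
  shows "fps_total (thin s f) = fps_total f"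
proof -
  define b where "b x k = real (x choose k) * (1 - s) ^ k * s ^ (x - k)" for x k
  have "(\<lambda>N. \<Sum>x. fps_nth f x * (\<Sum>k<N. b x k)) \<longlonglongrightarrow> (\<Sum>x. fps_nth f x)"
  proof (rule conjunct2[OF conjunct2[OF tannerys_theorem]])
    show "(\<lambda>N. fps_nth f x * (\<Sum>k<N. b x k)) \<longlonglongrightarrow> fps_nth f x" for x
    proof -
      have "(\<Sum>k<N. b x k) = 1" if "N > x" for N
      proof -
        have "(\<Sum>k<N. b x k) = (\<Sum>k\<le>x. b x k)"
          using that by (intro sum.mono_neutral_right) (auto simp: b_def)
        then show ?thesis using binomial_ring[of "1 - s" s x] by (simp add: b_def)
      qed
      then have "eventually (\<lambda>N. fps_nth f x = fps_nth f x * (\<Sum>k<N. b x k)) sequentially"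
        by (intro eventually_sequentiallyI[of "Suc x"]) simp
      then show ?thesis by (rule Lim_transform_eventually[OF tendsto_const])
    qed
    have "norm (fps_nth f x * (\<Sum>k<N. b x k)) \<le> \<bar>fps_nth f x\<bar>" for x N
    proof -
      have "0 \<le> (\<Sum>k<N. b x k)" "(\<Sum>k<N. b x k) \<le> 1"
        using s sum_binomial_le_1[of x N] by (auto simp: b_def intro!: sum_nonneg)
      then show ?thesis by (simp add: abs_mult mult_left_le)
    qed
    then show "\<forall>\<^sub>F (x, N) in sequentially \<times>\<^sub>F sequentially.
        norm (fps_nth f x * (\<Sum>k<N. b x k)) \<le> \<bar>fps_nth f x\<bar>"
      by (intro always_eventually) auto
  qed (use f in \<open>auto simp: fps_l1_def\<close>)
  moreover have "(\<Sum>x. fps_nth f x * (\<Sum>k<N. b x k)) = (\<Sum>k<N. fps_nth (thin s f) k)" for N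
    using sums_sum[of "{..<N}", OF thin_nth_sums[OF fps_l1_conv_radius[OF f]]]
    by (simp add: sums_iff sum_distrib_left b_def)
  ultimately show ?thesis
    by (intro fps_total_eqI) (simp add: sums_def fps_total_def)
qed

end

text \<open>This is \<open>d/ds f(s + (1 - s) z) = (1 - z) f'(s + (1 - s) z)\<close>, read off
  coefficientwise.\<close>

lemma thin_has_derivative:
  assumes s: "0 \<le> s" "s < 1" and f: "1 \<le> fps_conv_radius f"
  shows "((\<lambda>s. fps_nth (thin s f) k) has_real_derivative
      fps_nth ((1 - fps_X) * thin s (fps_deriv f)) k) (at s)"
proof -
  have d: "(eval_fps ((fps_deriv ^^ k) f) has_real_derivative eval_fps ((fps_deriv ^^ k) (fps_deriv f)) s) (at s)" for k
    using has_field_derivative_eval_fps[of s "(fps_deriv ^^ k) f" UNIV] higher_deriv_conv_radius_gt[OF s f, of k]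
    by (simp add: funpow_swap1)
  have "((\<lambda>s. (1 - s) ^ k / fact k * eval_fps ((fps_deriv ^^ k) f) s) has_real_derivative
     ((1 - s) ^ k / fact k * eval_fps ((fps_deriv ^^ k) (fps_deriv f)) s
      - real k * (1 - s) ^ (k - 1) / fact k * eval_fps ((fps_deriv ^^ k) f) s)) (at s)"
    by (auto intro!: derivative_eq_intros d simp: diff_divide_distrib mult_ac)
  also have "((1 - s) ^ k / fact k * eval_fps ((fps_deriv ^^ k) (fps_deriv f)) s
      - real k * (1 - s) ^ (k - 1) / fact k * eval_fps ((fps_deriv ^^ k) f) s) =
      fps_nth ((1 - fps_X) * thin s (fps_deriv f)) k"
  proof (cases k)
    \<comment> \<open>Differentiating \<open>(1 - s) ^ k\<close> yields minus coefficient
      \<open>k - 1\<close> of the thinned derivative, which is the contribution of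
      \<open>- fps_X\<close>.\<close>
    case (Suc m)
    have "(fps_deriv ^^ Suc m) f = (fps_deriv ^^ m) (fps_deriv f)"
      by (simp add: funpow_swap1)
    moreover have "real (Suc m) * x / fact (Suc m) = x / fact m" for x :: real
      unfolding fact_Suc by (simp del: of_nat_Suc)
    ultimately show ?thesis
      unfolding Suc left_diff_distrib fps_sub_nth fps_X_mult_nth thin_nth
      by (simp add: thin_nth del: funpow.simps of_nat_Suc fact_Suc)
  qed (simp add: thin_nth left_diff_distrib)
  finally show ?thesis
    unfolding thin_nth .
qed

text \<open>As \<open>s\<close> tends to 1 the survival probability vanishes and all mass gathers at
  index 0, where the limit is the total, here 0. Tannery's theorem again justifies the termwise
  limit.\<close>

lemma thin_nth_tendsto_0:
  assumes f: "fps_l1 f" and total: "fps_total f = 0"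
  shows "((\<lambda>s. fps_nth (thin s f) k) \<longlongrightarrow> 0) (at_left 1)"
proof -
  define b where "b s x = real (x choose k) * (1 - s) ^ k * s ^ (x - k)" for s x
  have ev: "eventually (\<lambda>s. s \<in> {0<..<1::real}) (at_left 1)"
    by (rule eventually_at_left_real) simp
  have "((\<lambda>s. \<Sum>x. fps_nth f x * b s x) \<longlongrightarrow> (\<Sum>x. fps_nth f x * b 1 x)) (at_left 1)"
  proof (rule conjunct2[OF conjunct2[OF tannerys_theorem]])
    show "((\<lambda>s. fps_nth f x * b s x) \<longlongrightarrow> fps_nth f x * b 1 x) (at_left 1)" for x
      unfolding b_def by (intro tendsto_intros)
    have "norm (fps_nth f x * b s x) \<le> \<bar>fps_nth f x\<bar>" if "s \<in> {0<..<1}" for x s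
    proof -
      have "b s x \<le> (\<Sum>k<Suc k. real (x choose k) * (1 - s) ^ k * s ^ (x - k))"
        unfolding b_def using that by (intro member_le_sum) auto
      also have "\<dots> \<le> 1" using that by (intro sum_binomial_le_1) auto
      finally have "b s x \<le> 1" .
      moreover have "0 \<le> b s x" using that by (simp add: b_def)
      ultimately show ?thesis by (simp add: abs_mult mult_left_le)
    qed
    then show "\<forall>\<^sub>F (x, s) in sequentially \<times>\<^sub>F at_left 1. norm (fps_nth f x * b s x) \<le> \<bar>fps_nth f x\<bar>"
      unfolding eventually_prod_filter using ev
      by (intro exI[of _ "\<lambda>_. True"] exI[of _ "\<lambda>s. s \<in> {0<..<1}"]) auto
  qed (use f in \<open>auto simp: fps_l1_def\<close>)
  moreover have "(\<Sum>x. fps_nth f x * b 1 x) = 0"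
  proof (cases k)
    case 0
    then show ?thesis using total by (simp add: b_def fps_total_def)
  qed (simp add: b_def)
  moreover have "eventually (\<lambda>s. (\<Sum>x. fps_nth f x * b s x) = fps_nth (thin s f) k) (at_left 1)"
    using ev
  proof eventually_elim
    case (elim s)
    then show ?case
      using thin_nth_sums[of s f k] fps_l1_conv_radius[OF f] by (simp add: sums_iff b_def)
  qed
  ultimately show ?thesis
    using Lim_transform_eventually[of "\<lambda>s. \<Sum>x. fps_nth f x * b s x" 0 "at_left 1"
      "\<lambda>s. fps_nth (thin s f) k"] by simp
qed

section \<open>Discrete self-decomposability and the monotone case\<close>

text \<open>The series of \<open>exp (\<mu> (z - 1))\<close>. Negative arguments occur as well:
  \<open>poisson_fps (- \<mu>)\<close> inverts \<open>poisson_fps \<mu>\<close>, which serves to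
  divide out a Poisson factor.\<close>

definition poisson_fps :: "real \<Rightarrow> real fps" where
  "poisson_fps \<mu> = fps_const (exp (- \<mu>)) * fps_exp \<mu>"

lemma poisson_fps_nth: "fps_nth (poisson_fps \<mu>) n = exp (- \<mu>) * \<mu> ^ n / fact n"
  by (simp add: poisson_fps_def)

lemma poisson_fps_sums: "fps_nth (poisson_fps \<mu>) sums 1"
proof -
  have "(\<lambda>n. exp (- \<mu>) * (\<mu> ^ n / fact n)) sums (exp (- \<mu>) * exp \<mu>)"
    using exp_converges[of \<mu>] by (intro sums_mult) (simp add: field_simps)
  moreover have "(\<lambda>n. exp (- \<mu>) * (\<mu> ^ n / fact n)) = fps_nth (poisson_fps \<mu>)"
    by (auto simp: poisson_fps_nth)
  ultimately show ?thesis by (simp flip: exp_add)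
qed

lemma fps_l1_poisson: "fps_l1 (poisson_fps \<mu>)"
proof -
  have "summable (\<lambda>n. exp (- \<mu>) * (\<bar>\<mu>\<bar> ^ n / fact n))"
    using summable_exp[of "\<bar>\<mu>\<bar>"] by (intro summable_mult) (simp add: field_simps)
  then show ?thesis
    by (simp add: fps_l1_def poisson_fps_nth abs_mult power_abs)
qed

lemma fps_total_poisson: "fps_total (poisson_fps \<mu>) = 1"
  by (rule fps_total_eqI[OF poisson_fps_sums])

text \<open>The left-hand side is \<open>E\<bar>X - \<mu>\<bar> / \<mu>\<close> for a Poisson variable \<open>X\<close>, as
  \<open>n p(n) = \<mu> p(n - 1)\<close>; its variance is \<open>\<mu>\<close>.\<close>
lemma l1_norm_diff_poisson:
  assumes "\<mu> > 0"
  shows "l1_norm ((1 - fps_X) * poisson_fps \<mu>) \<le> 1 / sqrt \<mu>"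
proof -
  define p where "p = fps_nth (poisson_fps \<mu>)"
  have p: "p n \<ge> 0" for n using assms by (simp add: p_def poisson_fps_nth)
  have rec: "real (Suc n) * p (Suc n) = \<mu> * p n" for n
    unfolding p_def poisson_fps_nth fact_Suc power_Suc by (simp del: of_nat_Suc)
  have s0: "p sums 1" unfolding p_def by (rule poisson_fps_sums)
  have s1: "(\<lambda>n. real n * p n) sums \<mu>"
    using sums_Suc[of "\<lambda>n. real n * p n" \<mu>] sums_mult[OF s0, of \<mu>] by (simp only: rec) simp
  have s2: "(\<lambda>n. real n * (real n * p n)) sums (\<mu>\<^sup>2 + \<mu>)"
  proof -
    have "(\<lambda>n. \<mu> * (real n * p n) + \<mu> * p n) sums (\<mu> * \<mu> + \<mu> * 1)"
      by (intro sums_add sums_mult s1 s0)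
    moreover have "real (Suc n) * (real (Suc n) * p (Suc n)) = \<mu> * (real n * p n) + \<mu> * p n" for n
      unfolding rec by (simp add: algebra_simps)
    ultimately show ?thesis
      using sums_Suc[of "\<lambda>n. real n * (real n * p n)" "\<mu> * \<mu> + \<mu> * 1"] by (simp add: power2_eq_square)
  qed
  \<comment> \<open>This is \<open>p n * ((n - \<mu>)\<^sup>2 + \<mu>) / (2 * \<mu> * sqrt
    \<mu>)\<close>, expanded into moments. It majorizes
    \<open>p n * \<bar>n - \<mu>\<bar> / \<mu>\<close> by the arithmetic-geometric mean inequality,
    balanced so that its sum is exactly \<open>1 / sqrt \<mu>\<close>.\<close>
  define b where "b n = (real n * (real n * p n) - 2 * \<mu> * (real n * p n) + (\<mu>\<^sup>2 + \<mu>) * p n) / (2 * \<mu> * sqrt \<mu>)" for n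
  have "b sums ((\<mu>\<^sup>2 + \<mu> - 2 * \<mu> * \<mu> + (\<mu>\<^sup>2 + \<mu>) * 1) / (2 * \<mu> * sqrt \<mu>))"
    unfolding b_def by (intro sums_divide sums_add sums_diff sums_mult s0 s1 s2)
  moreover have "(\<mu>\<^sup>2 + \<mu> - 2 * \<mu> * \<mu> + (\<mu>\<^sup>2 + \<mu>) * 1) / (2 * \<mu> * sqrt \<mu>) = 1 / sqrt \<mu>"
    using assms by (simp add: power2_eq_square)
  ultimately have b: "b sums (1 / sqrt \<mu>)" by simp
  have d: "fps_nth ((1 - fps_X) * poisson_fps \<mu>) n = p n * (1 - real n / \<mu>)" for n
  proof (cases n)
    case (Suc m)
    have "p m = p n * real n / \<mu>" using rec[of m] assms Suc by (simp add: field_simps)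
    then show ?thesis using Suc by (simp add: left_diff_distrib p_def[symmetric] right_diff_distrib)
  qed (simp add: left_diff_distrib p_def)
  have le: "\<bar>fps_nth ((1 - fps_X) * poisson_fps \<mu>) n\<bar> \<le> b n" for n
  proof -
    define t where "t = sqrt \<mu>"
    have t: "t > 0" "\<mu> = t\<^sup>2" using assms by (simp_all add: t_def)
    have "2 * t * \<bar>real n - \<mu>\<bar> \<le> (real n - \<mu>)\<^sup>2 + \<mu>"
      using zero_le_power2[of "\<bar>real n - \<mu>\<bar> - t"] by (simp add: power2_diff t(2) mult_ac)
    then have "\<bar>real n - \<mu>\<bar> / \<mu> \<le> ((real n - \<mu>)\<^sup>2 + \<mu>) / (2 * \<mu> * t)"
      using t assms by (simp add: field_simps)
    moreover have "\<bar>1 - real n / \<mu>\<bar> = \<bar>real n - \<mu>\<bar> / \<mu>"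
      using assms by (simp add: abs_div_pos diff_divide_distrib abs_minus_commute)
    ultimately have "p n * \<bar>1 - real n / \<mu>\<bar> \<le> p n * (((real n - \<mu>)\<^sup>2 + \<mu>) / (2 * \<mu> * t))"
      using p by (intro mult_left_mono) auto
    also have "\<dots> = b n"
      by (simp add: b_def t_def power2_diff algebra_simps power2_eq_square)
    finally show ?thesis using p by (simp add: d abs_mult)
  qed
  have "summable (\<lambda>n. \<bar>fps_nth ((1 - fps_X) * poisson_fps \<mu>) n\<bar>)"
    by (rule summable_comparison_test'[of b 0]) (use b le in \<open>auto simp: sums_iff\<close>)
  then show ?thesis
    unfolding l1_norm_def using b le by (intro sums_le[OF _ summable_sums b]) auto
qed

lemma deriv_poisson_fps: "fps_deriv (poisson_fps \<mu>) = fps_const \<mu> * poisson_fps \<mu>"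
  by (simp add: poisson_fps_def mult_ac)

text \<open>The binomial series for the exponent \<open>- (n + 1)\<close>; up to a factor, these are
  the weights that occur when a constant sequence is thinned.\<close>

lemma neg_binomial_sums:
  fixes s :: real
  assumes "\<bar>s\<bar> < 1"
  shows "(\<lambda>x. real ((x + n) choose n) * s ^ x) sums (1 / (1 - s) ^ Suc n)"
proof -
  have "(\<lambda>k. (- real (Suc n) gchoose k) * (- s) ^ k) sums (1 + - s) powr (- real (Suc n))"
    using assms by (intro gen_binomial_real) auto
  also have "(\<lambda>k. (- real (Suc n) gchoose k) * (- s) ^ k) = (\<lambda>x. real ((x + n) choose n) * s ^ x)"
  proof
    fix k
    have "(- real (Suc n) gchoose k) = (- 1) ^ k * real ((k + n) choose k)"
      by (subst gbinomial_minus) (simp add: binomial_gbinomial add_ac)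
    also have "(k + n) choose k = (k + n) choose n"
      by (subst binomial_symmetric) auto
    finally show "(- real (Suc n) gchoose k) * (- s) ^ k = real ((k + n) choose n) * s ^ k"
      using power_minus[of s k] by (cases "even k") auto
  qed
  also have "(1 + - s) powr (- real (Suc n)) = 1 / (1 - s) ^ Suc n"
    using assms powr_realpow[of "1 - s" "Suc n"] by (simp only: powr_minus divide_inverse) simp
  finally show ?thesis .
qed

text \<open>In the application \<open>\<theta> = \<lambda> q'\<close> and
  \<open>G = exp (\<lambda> (q - 1))\<close>, with \<open>q\<close> the generating function of the
  compounded distribution. Summability of \<open>\<theta>\<close> encodes its finite mean.\<close>

locale fps_compound_poisson =
  fixes \<theta> G :: "real fps"
  assumes deriv_G: "fps_deriv G = \<theta> * G"
    and G_nonneg: "\<And>n. 0 \<le> fps_nth G n" and G0: "0 < fps_nth G 0"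
    and l1_G: "fps_l1 G" and total_G: "fps_total G = 1"
    and \<theta>_nonneg: "\<And>n. 0 \<le> fps_nth \<theta> n" and l1_\<theta>: "fps_l1 \<theta>"
begin

text \<open>Formally a compound Poisson series with the sign of the rate reversed. Its coefficients
  may be negative, but turn out to be absolutely summable.\<close>

definition "K = inverse G"

lemma K_G: "K * G = 1"
  using G0 by (simp add: K_def inverse_mult_eq_1)

lemma deriv_K: "fps_deriv K = - \<theta> * K"
proof -
  have "fps_deriv K = - (\<theta> * G) * K\<^sup>2"
    using fps_inverse_deriv[of G] G0 by (simp add: K_def deriv_G)
  also have "\<dots> = - \<theta> * (K * G) * K" by (simp add: power2_eq_square mult_ac)
  finally show ?thesis by (simp add: K_G)
qed

text \<open>\<open>K\<close> obeys the recursion of \<open>G\<close> with \<open>- \<theta>\<close>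
  in place of \<open>\<theta>\<close>. In absolute values it becomes the recursion of
  \<open>G\<close> as an inequality, started at \<open>1 / G(0)\<close>, and
  \<open>G / G(0)\<^sup>2\<close> solves it with equality.\<close>

lemma abs_K_le: "\<bar>fps_nth K n\<bar> \<le> fps_nth G n / (fps_nth G 0)\<^sup>2"
proof (induction n rule: less_induct)
  case (less n)
  show ?case
  proof (cases n)
    case 0
    have "fps_nth K 0 * fps_nth G 0 = 1"
      using K_G by (metis fps_mult_nth_0 fps_one_nth)
    then show ?thesis using G0 0 by (simp add: field_simps power2_eq_square)
  next
    case (Suc m)
    have "real (Suc m) * \<bar>fps_nth K (Suc m)\<bar> = \<bar>fps_nth (fps_deriv K) m\<bar>"
      by (simp add: abs_mult)
    also have "\<dots> = \<bar>\<Sum>i=0..m. fps_nth \<theta> i * fps_nth K (m - i)\<bar>"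
      unfolding deriv_K by (simp add: fps_mult_nth sum_negf)
    also have "\<dots> \<le> (\<Sum>i=0..m. fps_nth \<theta> i * (fps_nth G (m - i) / (fps_nth G 0)\<^sup>2))"
      using less Suc \<theta>_nonneg
      by (intro order.trans[OF sum_abs] sum_mono) (auto simp: abs_mult simp del: times_divide_eq_right intro!: mult_left_mono)
    also have "\<dots> = fps_nth (\<theta> * G) m / (fps_nth G 0)\<^sup>2"
      by (simp add: fps_mult_nth sum_divide_distrib)
    also have "\<dots> = real (Suc m) * (fps_nth G (Suc m) / (fps_nth G 0)\<^sup>2)"
      unfolding deriv_G[symmetric] by simp
    finally show ?thesis
      unfolding Suc by (rule mult_left_le_imp_le) simp
  qed
qed

lemma l1_K: "fps_l1 K"
  unfolding fps_l1_def
proof (rule summable_comparison_test'[of "\<lambda>n. fps_nth G n / (fps_nth G 0)\<^sup>2" 0])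
  show "summable (\<lambda>n. fps_nth G n / (fps_nth G 0)\<^sup>2)"
    using fps_l1_summable[OF l1_G] by (rule summable_divide)
qed (use abs_K_le in auto)

lemma total_K: "fps_total K = 1"
  using fps_total_mult[OF l1_K l1_G] K_G total_G by simp

text \<open>Since \<open>thin s K\<close> is \<open>1 / G(s + (1 - s) z)\<close>, this is the factor
  \<open>C\<^sub>s(z)\<close> of discrete self-decomposability.\<close>

definition remainder :: "real \<Rightarrow> real fps" where
  "remainder s = thin s K * G"

text \<open>Logarithmic derivatives subtract: \<open>G\<close> has \<open>\<theta>\<close>, and its
  thinning has \<open>(1 - s) \<theta>(s + (1 - s) z)\<close> by the chain rule.\<close>

lemma deriv_remainder:
  assumes s: "0 \<le> s" "s < 1"
  shows "fps_deriv (remainder s) = (\<theta> - fps_const (1 - s) * thin s \<theta>) * remainder s"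
proof -
  have "thin s (- \<theta> * K) = thin s (- \<theta>) * thin s K"
    by (intro thin_mult fps_l1_conv_radius fps_l1_uminus l1_\<theta> l1_K s)
  moreover have "thin s (- \<theta>) = - thin s \<theta>"
    using thin_add[OF s, of \<theta> "- \<theta>"] fps_l1_conv_radius[OF l1_\<theta>]
    by (simp add: eq_neg_iff_add_eq_0 add.commute thin_zero)
  ultimately show ?thesis
    unfolding remainder_def
    by (simp add: deriv_thin deriv_K deriv_G algebra_simps)
qed

text \<open>The constant coefficient is \<open>G(0) / G(s)\<close>.\<close>

lemma remainder_0_nonneg:
  assumes s: "0 \<le> s" "s < 1"
  shows "0 \<le> fps_nth (remainder s) 0"
proof -
  have r: "ereal (norm s) < fps_conv_radius G" "ereal (norm s) < fps_conv_radius K"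
    using conv_radius_gt[OF s] fps_l1_conv_radius l1_G l1_K by auto
  have "eval_fps K s * eval_fps G s = 1"
    using eval_fps_mult[OF r(2,1)] by (simp add: K_G)
  moreover have "0 \<le> eval_fps G s"
    unfolding eval_fps_def using s summable_fps[OF r(1)] G_nonneg
    by (intro suminf_nonneg) auto
  ultimately have "0 \<le> eval_fps K s"
    by (metis mult_neg_pos mult_zero_right less_eq_real_def linorder_not_less not_one_le_zero zero_less_one)
  then show ?thesis
    using G0 by (simp add: remainder_def thin_nth)
qed

lemma total_remainder:
  assumes s: "0 \<le> s" "s < 1"
  shows "fps_l1 (remainder s)" "fps_total (remainder s) = 1"
  using fps_l1_thin[OF s l1_K] l1_G
  by (auto simp: remainder_def fps_total_mult fps_total_thin[OF s l1_K] total_K total_G)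

section \<open>Non-increasing \<open>\<theta>\<close>: the remainder as a probability generating
  function\<close>

context
  assumes antimono: "\<And>m n. m \<le> n \<Longrightarrow> fps_nth \<theta> n \<le> fps_nth \<theta> m"
begin

text \<open>Monotonicity bounds every coefficient from index \<open>n\<close> on by coefficient
  \<open>n\<close>, and thinning a constant sequence multiplies it by
  \<open>1 / (1 - s)\<close>.\<close>

lemma thin_\<theta>_le:
  assumes s: "0 \<le> s" "s < 1"
  shows "(1 - s) * fps_nth (thin s \<theta>) n \<le> fps_nth \<theta> n"
proof -
  have "(\<lambda>x. real ((x + n) choose n) * s ^ x) sums (1 / (1 - s) ^ Suc n)"
    using neg_binomial_sums[of s n] s by simp
  then have "(\<lambda>x. fps_nth \<theta> n * ((1 - s) ^ n * (real ((x + n) choose n) * s ^ x)))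
      sums (fps_nth \<theta> n * ((1 - s) ^ n * (1 / (1 - s) ^ Suc n)))"
    by (intro sums_mult)
  then have 1: "(\<lambda>x. fps_nth \<theta> n * (real ((x + n) choose n) * (1 - s) ^ n * s ^ (x + n - n)))
      sums (fps_nth \<theta> n / (1 - s))"
    using s by (simp add: mult_ac)
  have 2: "(\<lambda>x. fps_nth \<theta> (x + n) * (real ((x + n) choose n) * (1 - s) ^ n * s ^ (x + n - n)))
      sums fps_nth (thin s \<theta>) n"
    using thin_nth_sums[OF s fps_l1_conv_radius[OF l1_\<theta>], of n]
    by (subst sums_zero_iff_shift) auto
  have "fps_nth (thin s \<theta>) n \<le> fps_nth \<theta> n / (1 - s)"
    by (rule sums_le[OF _ 2 1]) (use s antimono in \<open>auto intro!: mult_right_mono\<close>)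
  then show ?thesis using s by (simp add: field_simps)
qed

text \<open>Here the tail from index 1 is bounded by \<open>\<theta>\<^sub>1\<close> instead of
  \<open>\<theta>\<^sub>0\<close>. The gain \<open>s (\<theta>\<^sub>0 - \<theta>\<^sub>1)\<close>
  is the mean of the Poisson factor.\<close>

lemma thin_\<theta>_0_le:
  assumes s: "0 \<le> s" "s < 1"
  shows "(1 - s) * fps_nth (thin s \<theta>) 0 \<le> fps_nth \<theta> 0 - s * (fps_nth \<theta> 0 - fps_nth \<theta> 1)"
proof -
  have 1: "(\<lambda>x. fps_nth \<theta> (Suc x) * s ^ Suc x) sums (fps_nth (thin s \<theta>) 0 - fps_nth \<theta> 0)"
    using thin_nth_sums[OF s fps_l1_conv_radius[OF l1_\<theta>], of 0]
    by (subst sums_Suc_iff) simp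
  have 2: "(\<lambda>x. fps_nth \<theta> 1 * (s * s ^ x)) sums (fps_nth \<theta> 1 * (s * (1 / (1 - s))))"
    using s by (intro sums_mult geometric_sums) auto
  have "fps_nth (thin s \<theta>) 0 - fps_nth \<theta> 0 \<le> fps_nth \<theta> 1 * (s * (1 / (1 - s)))"
    by (rule sums_le[OF _ 1 2]) (use s antimono[of 1] in \<open>auto intro!: mult_right_mono\<close>)
  then show ?thesis using s by (simp add: field_simps)
qed

lemma remainder_nonneg:
  assumes s: "0 \<le> s" "s < 1"
  shows "0 \<le> fps_nth (remainder s) n"
  by (rule fps_nth_nonneg_of_deriv[OF deriv_remainder[OF s] _ remainder_0_nonneg[OF s]])
    (use thin_\<theta>_le[OF s] in simp)

lemma l1_norm_diff_remainder:
  assumes s: "0 \<le> s" "s < 1"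
  shows "l1_norm ((1 - fps_X) * remainder s) \<le> 2"
proof -
  have "l1_norm ((1 - fps_X) * remainder s) \<le> l1_norm (1 - fps_X) * l1_norm (remainder s)"
    using total_remainder[OF s] by (intro l1_norm_mult) auto
  also have "l1_norm (1 - fps_X) = 2"
  proof -
    have "\<bar>fps_nth (1 - fps_X :: real fps) n\<bar> = fps_nth (1 + fps_X) n" for n
      by simp
    then have "l1_norm (1 - fps_X) = fps_total (1 + fps_X)"
      unfolding l1_norm_def fps_total_def by (simp only:)
    then show ?thesis by (simp add: fps_total_add)
  qed
  also have "l1_norm (remainder s) = 1"
    using remainder_nonneg[OF s] total_remainder[OF s] by (simp add: l1_norm_eq_total)
  finally show ?thesis by simp
qed

text \<open>The remainder is a Poisson law of mean \<open>\<mu>\<close> convolved with a probability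
  law \<open>D\<close>, and convolution with \<open>D\<close> does not increase the norm of the
  first difference.\<close>

lemma l1_norm_diff_remainder_sqrt:
  assumes s: "0 < s" "s < 1" and lt: "fps_nth \<theta> 1 < fps_nth \<theta> 0"
  shows "l1_norm ((1 - fps_X) * remainder s) \<le> 1 / sqrt (s * (fps_nth \<theta> 0 - fps_nth \<theta> 1))"
proof -
  define \<mu> where "\<mu> = s * (fps_nth \<theta> 0 - fps_nth \<theta> 1)"
  have \<mu>: "\<mu> > 0" using s lt by (simp add: \<mu>_def)
  have s': "0 \<le> s" "s < 1" using s by auto
  define D where "D = remainder s * poisson_fps (- \<mu>)"
  have P: "poisson_fps \<mu> * poisson_fps (- \<mu>) = 1"
  proof -
    have "poisson_fps \<mu> * poisson_fps (- \<mu>) =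
        fps_const (exp (- \<mu>) * exp \<mu>) * (fps_exp \<mu> * fps_exp (- \<mu>))"
      by (simp add: poisson_fps_def mult_ac flip: fps_const_mult)
    then show ?thesis by (simp flip: exp_add fps_exp_add_mult)
  qed
  have l1_D: "fps_l1 D" and total_D: "fps_total D = 1"
    using total_remainder[OF s'] fps_l1_poisson[of "- \<mu>"]
    by (auto simp: D_def fps_total_mult fps_total_poisson)
  have "fps_deriv D = (\<theta> - fps_const (1 - s) * thin s \<theta> - fps_const \<mu>) * D"
    by (simp add: D_def deriv_remainder[OF s'] deriv_poisson_fps algebra_simps flip: fps_const_neg)
  then have D_nonneg: "0 \<le> fps_nth D n" for n
  \<comment> \<open>Dividing out the Poisson factor lowers only the constant coefficient of the
    logarithmic derivative; the sharper bound at index 0 leaves exactly the room for it.\<close>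
  proof (rule fps_nth_nonneg_of_deriv)
    show "0 \<le> fps_nth (\<theta> - fps_const (1 - s) * thin s \<theta> - fps_const \<mu>) n" for n
      using thin_\<theta>_le[OF s', of n] thin_\<theta>_0_le[OF s'] by (cases n) (simp_all add: \<mu>_def)
    show "0 \<le> fps_nth D 0"
      using remainder_0_nonneg[OF s'] by (simp add: D_def poisson_fps_nth)
  qed
  have eq: "(1 - fps_X) * remainder s = ((1 - fps_X) * poisson_fps \<mu>) * D"
    using P by (simp add: D_def mult_ac)
  have "l1_norm ((1 - fps_X) * remainder s) \<le> l1_norm ((1 - fps_X) * poisson_fps \<mu>) * l1_norm D"
    unfolding eq by (intro l1_norm_mult fps_l1_mult fps_l1_diff fps_l1_1 fps_l1_X fps_l1_poisson l1_D)
  also have "\<dots> \<le> 1 / sqrt \<mu>"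
    using l1_norm_diff_poisson[OF \<mu>] D_nonneg total_D by (simp add: l1_norm_eq_total)
  finally show ?thesis by (simp add: \<mu>_def)
qed

end

section \<open>Interpolation between the two laws and the bounds for non-increasing
  \<open>\<theta>\<close>\<close>

text \<open>\<open>thin s ((F - G) / G) * G\<close> interpolates between \<open>F - G\<close> at \<open>s = 0\<close> and \<open>0\<close> at \<open>s = 1\<close>.\<close>
lemma distance_le_interpolation:
  fixes F :: "real fps"
  defines "\<rho> \<equiv> fps_deriv F - \<theta> * F"
  assumes l1_F: "fps_l1 F" and total_F: "fps_total F = 1" and l1_\<rho>: "fps_l1 \<rho>"
    and h_cont: "continuous_on {0..1} h" and h0: "h 0 = 0"
    and h_deriv: "\<And>s. 0 < s \<Longrightarrow> s < 1 \<Longrightarrow> (h has_real_derivative h' s) (at s)"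
    and h': "\<And>s. 0 < s \<Longrightarrow> s < 1 \<Longrightarrow> l1_norm ((1 - fps_X) * remainder s) \<le> h' s"
  shows "(\<Sum>n<N. \<bar>fps_nth F n - fps_nth G n\<bar>) \<le> l1_norm \<rho> * h 1"
proof -
  define A where "A = (F - G) * K"
  have l1_A: "fps_l1 A" unfolding A_def using l1_F l1_G l1_K by auto
  have total_A: "fps_total A = 0"
    unfolding A_def using l1_F l1_G l1_K total_F total_G
    by (subst fps_total_mult) (auto simp: fps_total_diff)
  have deriv_A: "fps_deriv A = \<rho> * K"
    by (simp add: A_def deriv_K deriv_G \<rho>_def algebra_simps)
  have A_G: "A * G = F - G"
    using K_G by (simp add: A_def mult.assoc)
  \<comment> \<open>Fixing the signs as they are at \<open>s = 0\<close> turns the partial sum of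
    absolute values into a linear functional, which is differentiable along the path.\<close>
  define \<epsilon> where "\<epsilon> n = sgn (fps_nth F n - fps_nth G n)" for n
  define \<phi> where "\<phi> s = (\<Sum>n<N. \<epsilon> n * fps_nth (thin s A * G) n)" for s
  have \<phi>0: "\<phi> 0 = (\<Sum>n<N. \<bar>fps_nth F n - fps_nth G n\<bar>)"
    unfolding \<phi>_def thin_0 A_G \<epsilon>_def by (simp add: abs_sgn mult.commute)
  have \<phi>_deriv: "(\<phi> has_real_derivative
      (\<Sum>n<N. \<epsilon> n * fps_nth (thin s \<rho> * ((1 - fps_X) * remainder s)) n)) (at s)"
    if s: "0 \<le> s" "s < 1" for s
  proof -
    \<comment> \<open>As \<open>A' = \<rho> K\<close>, thinning \<open>A'\<close> produces
      \<open>thin s K\<close>, which together with \<open>G\<close> is the remainder.\<close>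
    have t: "thin s (\<rho> * K) = thin s \<rho> * thin s K"
      by (intro thin_mult s fps_l1_conv_radius l1_\<rho> l1_K)
    have "thin s \<rho> * ((1 - fps_X) * remainder s) = (1 - fps_X) * thin s (fps_deriv A) * G"
      unfolding deriv_A t remainder_def by (simp add: mult_ac)
    moreover have "(\<phi> has_real_derivative
        (\<Sum>n<N. \<epsilon> n * fps_nth ((1 - fps_X) * thin s (fps_deriv A) * G) n)) (at s)"
      unfolding \<phi>_def fps_mult_nth[of _ G]
      by (intro DERIV_sum DERIV_cmult DERIV_cmult_right thin_has_derivative s fps_l1_conv_radius l1_A)
    ultimately show ?thesis by (simp only:)
  qed
  have \<phi>'_le: "\<bar>\<Sum>n<N. \<epsilon> n * fps_nth (thin s \<rho> * ((1 - fps_X) * remainder s)) n\<bar> \<le> l1_norm \<rho> * h' s"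
    if s: "0 < s" "s < 1" for s
  proof -
    have s': "0 \<le> s" "s < 1" using s by auto
    let ?f = "thin s \<rho> * ((1 - fps_X) * remainder s)"
    have l: "fps_l1 (thin s \<rho>)" "fps_l1 ((1 - fps_X) * remainder s)"
      using fps_l1_thin[OF s' l1_\<rho>] total_remainder[OF s'] by auto
    have "\<bar>\<Sum>n<N. \<epsilon> n * fps_nth ?f n\<bar> \<le> (\<Sum>n<N. \<bar>fps_nth ?f n\<bar>)"
      by (intro order.trans[OF sum_abs] sum_mono) (auto simp: abs_mult \<epsilon>_def sgn_if)
    also have "\<dots> \<le> l1_norm ?f"
      using l by (intro sum_abs_le_l1_norm) auto
    also have "\<dots> \<le> l1_norm (thin s \<rho>) * l1_norm ((1 - fps_X) * remainder s)"
      by (intro l1_norm_mult l)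
    also have "\<dots> \<le> l1_norm \<rho> * h' s"
      by (intro mult_mono h' s l1_norm_thin s' l1_\<rho> l1_norm_nonneg l)
    finally show ?thesis .
  qed
  \<comment> \<open>The derivative of \<open>\<phi> + \<parallel>\<rho>\<parallel> h\<close> is
    non-negative. The comparison ends below 1, where thinning is differentiable, and uses
    derivatives only in the open interval, since \<open>h'\<close> may blow up at 0.\<close>
  have le: "\<phi> 0 \<le> \<phi> s + l1_norm \<rho> * h s" if s: "0 < s" "s < 1" for s
  proof -
    have "\<phi> 0 + l1_norm \<rho> * h 0 \<le> \<phi> s + l1_norm \<rho> * h s"
    proof (rule DERIV_nonneg_imp_increasing_open[where f = "\<lambda>s. \<phi> s + l1_norm \<rho> * h s"])
      show "\<exists>y. ((\<lambda>s. \<phi> s + l1_norm \<rho> * h s) has_real_derivative y) (at x) \<and> 0 \<le> y"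
        if x: "0 < x" "x < s" for x
      proof -
        have x': "0 \<le> x" "x < 1" "0 < x" using x s by auto
        have "((\<lambda>s. \<phi> s + l1_norm \<rho> * h s) has_real_derivative
            (\<Sum>n<N. \<epsilon> n * fps_nth (thin x \<rho> * ((1 - fps_X) * remainder x)) n) + l1_norm \<rho> * h' x) (at x)"
          by (intro DERIV_add DERIV_cmult \<phi>_deriv h_deriv x')
        then show ?thesis using \<phi>'_le[of x] x' by (intro exI conjI) (assumption, linarith)
      qed
      have "continuous_on {0..s} \<phi>"
        using s by (intro DERIV_continuous_on[OF DERIV_subset[OF \<phi>_deriv]]) auto
      then show "continuous_on {0..s} (\<lambda>s. \<phi> s + l1_norm \<rho> * h s)"
        using s by (intro continuous_intros continuous_on_subset[OF h_cont]) auto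
    qed (use s in simp)
    then show ?thesis by (simp add: h0)
  qed
  \<comment> \<open>\<open>A\<close> thins out to its total 0, so the distance is bounded by the
    whole increment of \<open>h\<close>.\<close>
  have "(\<phi> \<longlongrightarrow> (\<Sum>n<N. \<epsilon> n * (\<Sum>i=0..n. 0 * fps_nth G (n - i)))) (at_left 1)"
    unfolding \<phi>_def fps_mult_nth
    by (intro tendsto_intros thin_nth_tendsto_0 l1_A total_A)
  then have \<phi>_lim: "(\<phi> \<longlongrightarrow> 0) (at_left 1)" by simp
  have "(h \<longlongrightarrow> h 1) (at 1 within {0..1})"
    using h_cont by (simp add: continuous_on)
  then have h_lim: "(h \<longlongrightarrow> h 1) (at_left 1)"
    by (simp add: at_within_Icc_at_left)
  have "((\<lambda>s. \<phi> s + l1_norm \<rho> * h s) \<longlongrightarrow> 0 + l1_norm \<rho> * h 1) (at_left 1)"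
    by (intro tendsto_intros \<phi>_lim h_lim)
  moreover have "eventually (\<lambda>s. \<phi> 0 \<le> \<phi> s + l1_norm \<rho> * h s) (at_left 1)"
    using eventually_at_left_real[of 0 1] by (auto elim!: eventually_mono intro: le)
  ultimately have "\<phi> 0 \<le> 0 + l1_norm \<rho> * h 1"
    by (intro tendsto_lowerbound) auto
  then show ?thesis by (simp add: \<phi>0)
qed

lemma distance_le_antimono:
  fixes F :: "real fps"
  defines "\<rho> \<equiv> fps_deriv F - \<theta> * F"
  assumes "fps_l1 F" "fps_total F = 1" "fps_l1 \<rho>"
    and "\<And>m n. m \<le> n \<Longrightarrow> fps_nth \<theta> n \<le> fps_nth \<theta> m"
  shows "(\<Sum>n<N. \<bar>fps_nth F n - fps_nth G n\<bar>) \<le> 2 * l1_norm \<rho>"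
  using distance_le_interpolation[of F "\<lambda>s. 2 * s" "\<lambda>_. 2" N] l1_norm_diff_remainder assms
  by (auto intro!: continuous_intros derivative_eq_intros)

text \<open>The smoothing bound \<open>1 / sqrt (s * c)\<close> has an integrable singularity at 0,
  with primitive \<open>2 * sqrt s / sqrt c\<close>.\<close>

lemma distance_le_antimono_sqrt:
  fixes F :: "real fps"
  defines "\<rho> \<equiv> fps_deriv F - \<theta> * F"
  assumes F: "fps_l1 F" "fps_total F = 1" "fps_l1 \<rho>"
    and mono: "\<And>m n. m \<le> n \<Longrightarrow> fps_nth \<theta> n \<le> fps_nth \<theta> m"
    and lt: "fps_nth \<theta> 1 < fps_nth \<theta> 0"
  shows "(\<Sum>n<N. \<bar>fps_nth F n - fps_nth G n\<bar>) \<le> 2 * l1_norm \<rho> / sqrt (fps_nth \<theta> 0 - fps_nth \<theta> 1)"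
proof -
  define c where "c = fps_nth \<theta> 0 - fps_nth \<theta> 1"
  have c: "c > 0" using lt by (simp add: c_def)
  have "(\<Sum>n<N. \<bar>fps_nth F n - fps_nth G n\<bar>) \<le> l1_norm \<rho> * (2 * sqrt 1 / sqrt c)"
    unfolding \<rho>_def
  proof (rule distance_le_interpolation[where h' = "\<lambda>s. 1 / sqrt (s * c)"])
    show "((\<lambda>s. 2 * sqrt s / sqrt c) has_real_derivative 1 / sqrt (s * c)) (at s)" if "0 < s" for s
      using that c by (auto intro!: derivative_eq_intros simp: real_sqrt_mult field_simps)
    show "l1_norm ((1 - fps_X) * remainder s) \<le> 1 / sqrt (s * c)" if "0 < s" "s < 1" for s
      unfolding c_def using that mono lt by (intro l1_norm_diff_remainder_sqrt)
  qed (use F lt in \<open>auto simp: c_def \<rho>_def intro!: continuous_intros\<close>)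
  then show ?thesis by (simp add: c_def mult.commute)
qed

end

section \<open>The general case\<close>

lemma eval_fps_mono:
  fixes f g :: "real fps"
  assumes "0 \<le> z" "z < 1" "1 \<le> fps_conv_radius f" "1 \<le> fps_conv_radius g"
    and "\<And>n. fps_nth f n \<le> fps_nth g n"
  shows "eval_fps f z \<le> eval_fps g z"
  unfolding eval_fps_def
proof (rule suminf_le)
  show "summable (\<lambda>n. fps_nth f n * z ^ n)" "summable (\<lambda>n. fps_nth g n * z ^ n)"
    using assms conv_radius_gt[of z] by (auto intro!: summable_fps)
qed (use assms in \<open>auto intro!: mult_right_mono\<close>)

lemma eval_fps_le_l1_norm:
  assumes "0 \<le> z" "z < 1" and f: "fps_l1 f"
  shows "eval_fps f z \<le> l1_norm f"
proof (rule sums_le[OF _ _ l1_norm_sums[OF f]])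
  show "(\<lambda>n. fps_nth f n * z ^ n) sums eval_fps f z"
    using assms conv_radius_gt[of z f] fps_l1_conv_radius[OF f] by (intro sums_eval_fps) auto
  show "fps_nth f n * z ^ n \<le> \<bar>fps_nth f n\<bar>" for n
  proof -
    have "fps_nth f n * z ^ n \<le> \<bar>fps_nth f n\<bar> * z ^ n"
      using assms by (intro mult_right_mono) auto
    also have "\<dots> \<le> \<bar>fps_nth f n\<bar>"
      using assms by (intro mult_left_le power_le_one) auto
    finally show ?thesis .
  qed
qed

context fps_compound_poisson
begin

text \<open>\<open>V = F - (F(0) / G(0)) G\<close> solves \<open>V' = \<theta> V + \<rho>\<close> with \<open>V(0) = 0\<close>.  The coefficientwise absolute
  value of \<open>V\<close>, truncated to a polynomial \<open>W\<close>, satisfies \<open>W' \<le> \<theta> W + \<bar>\<rho>\<bar>\<close> coefficientwise, and the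
  integrating factor \<open>exp (\<lambda> (1 - q(z)))\<close> bounds \<open>W\<close> on \<open>[0,1)\<close>.\<close>
lemma distance_le_integrating_factor:
  fixes F q :: "real fps" and lam :: real
  defines "\<rho> \<equiv> fps_deriv F - \<theta> * F"
  assumes lam: "0 < lam" and \<theta>: "\<theta> = fps_const lam * fps_deriv q"
    and q_nonneg: "\<And>n. 0 \<le> fps_nth q n" and l1_q: "fps_l1 q" and total_q: "fps_total q = 1"
    and l1_F: "fps_l1 F" and total_F: "fps_total F = 1" and l1_\<rho>: "fps_l1 \<rho>"
    and h_cont: "continuous_on {0..1} h" and h0: "h 0 = 0"
    and h_deriv: "\<And>s. 0 < s \<Longrightarrow> s < 1 \<Longrightarrow>
      (h has_real_derivative exp (lam * (1 - c * s))) (at s)"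
    and c: "c \<le> fps_nth q 1"
  shows "(\<Sum>n<N. \<bar>fps_nth F n - fps_nth G n\<bar>) \<le> 2 * l1_norm \<rho> * h 1"
proof -
  define a where "a = fps_nth F 0 / fps_nth G 0"
  define V where "V = F - fps_const a * G"
  have l1_V: "fps_l1 V" unfolding V_def using l1_F l1_G by auto
  have V0: "fps_nth V 0 = 0" using G0 by (simp add: V_def a_def)
  have deriv_V: "fps_deriv V = \<theta> * V + \<rho>"
    by (simp add: V_def deriv_G \<rho>_def algebra_simps)
  have V_le: "(\<Sum>n\<le>N. \<bar>fps_nth V n\<bar>) \<le> l1_norm \<rho> * h 1" for N
  proof -
    define W where "W = Abs_fps (\<lambda>n. if n \<le> N then \<bar>fps_nth V n\<bar> else 0)"
    have l1_W: "fps_l1 W" by (rule fps_l1_finite[of N]) (simp add: W_def)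
    have l1_W': "fps_l1 (fps_deriv W)" by (rule fps_l1_finite[of N]) (simp add: W_def)
    define r where "r = Abs_fps (\<lambda>n. \<bar>fps_nth \<rho> n\<bar>)"
    have l1_r: "fps_l1 r" using l1_\<rho> by (simp add: r_def fps_l1_def)
    have W_nonneg: "0 \<le> fps_nth W n" for n by (simp add: W_def)
    have "fps_nth (fps_deriv W) n \<le> fps_nth (\<theta> * W + r) n" for n
    \<comment> \<open>Below index \<open>N\<close> the coefficients of \<open>W'\<close> are those
      of \<open>V'\<close> in absolute value. From \<open>N\<close> on they vanish by truncation,
      while the right-hand side is non-negative.\<close>
    proof (cases "n < N")
      case True
      have "fps_nth (fps_deriv W) n = \<bar>fps_nth (fps_deriv V) n\<bar>"
        using True by (simp add: W_def abs_mult)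
      also have "\<dots> = \<bar>(\<Sum>i=0..n. fps_nth \<theta> i * fps_nth V (n - i)) + fps_nth \<rho> n\<bar>"
        by (simp add: deriv_V fps_mult_nth)
      also have "\<dots> \<le> (\<Sum>i=0..n. \<bar>fps_nth \<theta> i * fps_nth V (n - i)\<bar>) + \<bar>fps_nth \<rho> n\<bar>"
        by (intro order.trans[OF abs_triangle_ineq] add_right_mono sum_abs)
      also have "\<dots> = fps_nth (\<theta> * W + r) n"
        using True \<theta>_nonneg by (auto simp: fps_mult_nth W_def r_def abs_mult intro!: sum.cong)
      finally show ?thesis .
    next
      case False
      then show ?thesis
        using fps_mult_nth_nonneg[of \<theta> W n] \<theta>_nonneg W_nonneg by (simp add: W_def r_def)
    qed
    then have W'_le: "eval_fps (fps_deriv W) z \<le> eval_fps \<theta> z * eval_fps W z + l1_norm \<rho>"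
      if z: "0 \<le> z" "z < 1" for z
    proof -
      have "eval_fps (fps_deriv W) z \<le> eval_fps (\<theta> * W + r) z"
        using \<open>\<And>n. fps_nth (fps_deriv W) n \<le> fps_nth (\<theta> * W + r) n\<close>
        by (intro eval_fps_mono z fps_l1_conv_radius fps_l1_add fps_l1_mult l1_W' l1_\<theta> l1_W l1_r)
      also have "\<dots> = eval_fps \<theta> z * eval_fps W z + eval_fps r z"
      proof -
        have "ereal \<bar>z\<bar> < fps_conv_radius f" if "fps_l1 f" for f
          using conv_radius_gt[OF z fps_l1_conv_radius[OF that]] .
        then show ?thesis
          using l1_\<theta> l1_W l1_r by (subst eval_fps_add) (auto simp: eval_fps_mult)
      qed
      also have "eval_fps r z \<le> l1_norm r"
        by (intro eval_fps_le_l1_norm z l1_r)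
      also have "l1_norm r = l1_norm \<rho>" by (simp add: l1_norm_def r_def)
      finally show ?thesis by simp
    qed
    \<comment> \<open>\<open>u\<close> is \<open>1 / G\<close>, so \<open>(W u)' = (W' - \<theta> W)
      u \<le> \<parallel>\<rho>\<parallel> u\<close>; then \<open>q(z) \<ge> c z\<close> bounds
      \<open>u\<close> by the derivative of \<open>h\<close>.\<close>
    define u where "u z = exp (lam * (1 - eval_fps q z))" for z
    have q_bounds: "c * z \<le> eval_fps q z" "eval_fps q z \<le> 1" if z: "0 \<le> z" "z < 1" for z
    proof -
      have "(\<lambda>n. if n = 1 then fps_nth q n * z ^ n else 0) sums (fps_nth q 1 * z ^ 1)"
        by (rule sums_single)
      moreover have "(\<lambda>n. fps_nth q n * z ^ n) sums eval_fps q z"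
        using conv_radius_gt[OF z fps_l1_conv_radius[OF l1_q]] by (intro sums_eval_fps) simp
      ultimately have "fps_nth q 1 * z ^ 1 \<le> eval_fps q z"
        by (rule sums_le[rotated]) (use q_nonneg z in auto)
      moreover have "c * z \<le> fps_nth q 1 * z" using c z by (intro mult_right_mono) auto
      ultimately show "c * z \<le> eval_fps q z" by simp
      show "eval_fps q z \<le> 1"
        using eval_fps_le_l1_norm[OF z l1_q] q_nonneg total_q by (simp add: l1_norm_eq_total)
    qed
    have deriv_eval: "(eval_fps f has_real_derivative eval_fps (fps_deriv f) z) (at z)"
      if "0 \<le> z" "z < 1" "fps_l1 f" for z f
      using that conv_radius_gt[of z f] fps_l1_conv_radius[of f] by (intro has_field_derivative_eval_fps) auto
    have eval_\<theta>: "eval_fps \<theta> z = lam * eval_fps (fps_deriv q) z" if "0 \<le> z" "z < 1" for z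
    proof -
      have "1 \<le> fps_conv_radius (fps_deriv q)"
        using fps_conv_radius_deriv[of q] fps_l1_conv_radius[OF l1_q] by (rule order.trans[rotated])
      then show ?thesis
        unfolding \<theta> using conv_radius_gt[OF that] by (subst eval_fps_mult) auto
    qed
    have W_le: "eval_fps W z \<le> l1_norm \<rho> * h z" if z: "0 < z" "z < 1" for z
    proof -
      have "eval_fps W z * u z - l1_norm \<rho> * h z \<le> eval_fps W 0 * u 0 - l1_norm \<rho> * h 0"
      proof (rule DERIV_nonpos_imp_decreasing_open[where f = "\<lambda>z. eval_fps W z * u z - l1_norm \<rho> * h z"])
        show "\<exists>y. ((\<lambda>z. eval_fps W z * u z - l1_norm \<rho> * h z) has_real_derivative y) (at x) \<and> y \<le> 0"
          if x: "0 < x" "x < z" for x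
        proof -
          have x': "0 \<le> x" "x < 1" using x z by auto
          have "(u has_real_derivative u x * (lam * (- eval_fps (fps_deriv q) x))) (at x)"
            unfolding u_def
            by (auto intro!: derivative_eq_intros deriv_eval x' l1_q)
          then have "((\<lambda>z. eval_fps W z * u z - l1_norm \<rho> * h z) has_real_derivative
              eval_fps (fps_deriv W) x * u x + u x * (lam * (- eval_fps (fps_deriv q) x)) * eval_fps W x
              - l1_norm \<rho> * exp (lam * (1 - c * x))) (at x)"
            using x x' by (intro DERIV_diff DERIV_mult DERIV_cmult deriv_eval l1_W h_deriv) auto
          moreover have "eval_fps (fps_deriv W) x * u x + u x * (lam * (- eval_fps (fps_deriv q) x)) * eval_fps W x
              - l1_norm \<rho> * exp (lam * (1 - c * x)) \<le> 0"
          proof -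
            have "(eval_fps (fps_deriv W) x - eval_fps \<theta> x * eval_fps W x) * u x \<le> l1_norm \<rho> * u x"
              using W'_le[OF x'] by (intro mult_right_mono) (auto simp: u_def)
            also have "\<dots> \<le> l1_norm \<rho> * exp (lam * (1 - c * x))"
              using q_bounds[OF x'] lam l1_norm_nonneg[OF l1_\<rho>]
              by (intro mult_left_mono) (auto simp: u_def)
            finally show ?thesis by (simp add: eval_\<theta>[OF x'] algebra_simps)
          qed
          ultimately show ?thesis by blast
        qed
        have "continuous_on {0..z} (eval_fps W)" "continuous_on {0..z} (eval_fps q)"
          using z l1_W l1_q by (auto intro!: DERIV_continuous_on[OF DERIV_subset[OF deriv_eval]])
        then show "continuous_on {0..z} (\<lambda>z. eval_fps W z * u z - l1_norm \<rho> * h z)"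
          using z unfolding u_def
          by (intro continuous_on_diff continuous_on_mult continuous_on_exp continuous_on_const
              continuous_on_subset[OF h_cont]) auto
      qed (use z in auto)
      then have "eval_fps W z * u z \<le> l1_norm \<rho> * h z"
        using V0 by (simp add: h0 eval_fps_at_0 W_def)
      moreover have "eval_fps W z * 1 \<le> eval_fps W z * u z"
      proof (rule mult_left_mono)
        show "1 \<le> u z" using q_bounds[of z] z lam by (simp add: u_def)
        show "0 \<le> eval_fps W z"
          using eval_fps_mono[of z 0 W] z W_nonneg fps_l1_conv_radius[OF l1_W] by simp
      qed
      ultimately show ?thesis by simp
    qed
    \<comment> \<open>\<open>W\<close> is a polynomial, so letting \<open>z\<close> tend to 1
      recovers the partial sum of absolute values.\<close>
    have W_eval: "eval_fps W z = (\<Sum>n\<le>N. \<bar>fps_nth V n\<bar> * z ^ n)" for z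
      unfolding eval_fps_def by (subst suminf_finite[of "{..N}"]) (auto simp: W_def)
    have "(h \<longlongrightarrow> h 1) (at 1 within {0..1})"
      using h_cont by (simp add: continuous_on)
    then have h_lim: "(h \<longlongrightarrow> h 1) (at_left 1)"
      by (simp add: at_within_Icc_at_left)
    have "((\<lambda>z. \<Sum>n\<le>N. \<bar>fps_nth V n\<bar> * z ^ n) \<longlongrightarrow> (\<Sum>n\<le>N. \<bar>fps_nth V n\<bar> * 1 ^ n)) (at_left (1::real))"
      by (intro tendsto_intros)
    moreover have "((\<lambda>z. l1_norm \<rho> * h z) \<longlongrightarrow> l1_norm \<rho> * h 1) (at_left 1)"
      by (intro tendsto_intros h_lim)
    moreover have "eventually (\<lambda>z. (\<Sum>n\<le>N. \<bar>fps_nth V n\<bar> * z ^ n) \<le> l1_norm \<rho> * h z) (at_left (1::real))"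
      using eventually_at_left_real[of 0 1] W_le by (auto elim!: eventually_mono simp: W_eval)
    ultimately show ?thesis
      using tendsto_le[OF trivial_limit_at_left_real] by fastforce
  qed
  have norm_V: "l1_norm V \<le> l1_norm \<rho> * h 1"
  proof (rule fps_l1_bounded(2))
    show "(\<Sum>n<N. \<bar>fps_nth V n\<bar>) \<le> l1_norm \<rho> * h 1" for N
      by (rule order.trans[OF _ V_le[of N]], rule sum_mono2) auto
  qed
  \<comment> \<open>Both laws have total 1, so the mismatch \<open>a - 1\<close> is itself
    controlled by \<open>V\<close>. It costs a second copy of
    \<open>\<parallel>V\<parallel>\<close>, whence the factor 2.\<close>
  have "fps_total V = 1 - a"
    unfolding V_def using l1_F l1_G total_F total_G
    by (subst fps_total_diff) (auto simp: fps_total_mult)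
  moreover have "\<bar>fps_total V\<bar> \<le> l1_norm V"
    unfolding fps_total_def l1_norm_def using l1_V
    by (intro summable_rabs) (simp add: fps_l1_def)
  ultimately have a: "\<bar>a - 1\<bar> \<le> l1_norm V" by (simp add: abs_minus_commute)
  have "(\<Sum>n<N. \<bar>fps_nth F n - fps_nth G n\<bar>) \<le> (\<Sum>n<N. \<bar>fps_nth V n\<bar> + \<bar>a - 1\<bar> * \<bar>fps_nth G n\<bar>)"
  proof (rule sum_mono)
    fix n
    have "fps_nth F n - fps_nth G n = fps_nth V n + (a - 1) * fps_nth G n"
      by (simp add: V_def algebra_simps)
    then show "\<bar>fps_nth F n - fps_nth G n\<bar> \<le> \<bar>fps_nth V n\<bar> + \<bar>a - 1\<bar> * \<bar>fps_nth G n\<bar>"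
      by (metis abs_mult abs_triangle_ineq)
  qed
  also have "\<dots> = (\<Sum>n<N. \<bar>fps_nth V n\<bar>) + \<bar>a - 1\<bar> * (\<Sum>n<N. \<bar>fps_nth G n\<bar>)"
    by (simp add: sum.distrib sum_distrib_left)
  also have "\<dots> \<le> l1_norm V + l1_norm V * l1_norm G"
    by (intro add_mono mult_mono sum_abs_le_l1_norm l1_V l1_G a l1_norm_nonneg) auto
  also have "l1_norm G = 1"
    using G_nonneg total_G by (simp add: l1_norm_eq_total)
  finally show ?thesis using norm_V by simp
qed

text \<open>The two terms of the minimum come from two bounds on the integrating factor:
  \<open>c = 0\<close> gives the constant \<open>exp lam\<close>, and \<open>c = fps_nth q 1\<close>
  gives an exponential decay at rate \<open>b = lam * fps_nth q 1\<close>, with integral at most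
  \<open>exp lam / b\<close>.\<close>

lemma distance_le_exp:
  fixes F q :: "real fps" and lam :: real
  defines "\<rho> \<equiv> fps_deriv F - \<theta> * F"
  assumes lam: "0 < lam" and \<theta>: "\<theta> = fps_const lam * fps_deriv q"
    and q: "\<And>n. 0 \<le> fps_nth q n" "fps_l1 q" "fps_total q = 1" and q1: "0 < fps_nth q 1"
    and F: "fps_l1 F" "fps_total F = 1" "fps_l1 \<rho>"
  shows "(\<Sum>n<N. \<bar>fps_nth F n - fps_nth G n\<bar>) \<le>
    2 * l1_norm \<rho> * (exp lam * min 1 (1 / (lam * fps_nth q 1)))"
proof -
  have "(\<Sum>n<N. \<bar>fps_nth F n - fps_nth G n\<bar>) \<le> 2 * l1_norm \<rho> * (exp lam * 1)"
    unfolding \<rho>_def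
    by (rule distance_le_integrating_factor[where q = q and lam = lam and c = 0
        and h = "\<lambda>s. exp lam * s"])
      (use assms in \<open>auto intro!: continuous_intros derivative_eq_intros\<close>)
  moreover have "(\<Sum>n<N. \<bar>fps_nth F n - fps_nth G n\<bar>) \<le>
      2 * l1_norm \<rho> * (exp lam * (1 / (lam * fps_nth q 1)))"
  proof -
    define b where "b = lam * fps_nth q 1"
    have b: "b > 0" using lam q1 by (simp add: b_def)
    have "(\<Sum>n<N. \<bar>fps_nth F n - fps_nth G n\<bar>) \<le>
        2 * l1_norm \<rho> * (exp lam * (1 - exp (- b * 1)) / b)"
      unfolding \<rho>_def
    proof (rule distance_le_integrating_factor[where q = q and lam = lam and c = "fps_nth q 1"
          and h = "\<lambda>s. exp lam * (1 - exp (- b * s)) / b"])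
      show "((\<lambda>s. exp lam * (1 - exp (- b * s)) / b) has_real_derivative
          exp (lam * (1 - fps_nth q 1 * s))) (at s)" for s
        using b by (auto intro!: derivative_eq_intros simp: b_def algebra_simps simp flip: exp_add)
    qed (use assms b in \<open>auto intro!: continuous_intros\<close>)
    also have "\<dots> \<le> 2 * l1_norm \<rho> * (exp lam * (1 / b))"
      using b l1_norm_nonneg[OF F(3)] by (intro mult_left_mono) (auto simp: field_simps)
    finally show ?thesis by (simp add: b_def)
  qed
  ultimately show ?thesis
    by (cases "1 \<le> 1 / (lam * fps_nth q 1)") (simp_all add: min_def)
qed

end

section \<open>The score of an independent sum\<close>

text \<open>Cauchy-Schwarz with weights \<open>g\<close>, in a form that avoids dividing by
  \<open>g i\<close>, which may vanish.\<close>

lemma sum_squared_le_of_squares_le: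
  fixes t g w :: "'a \<Rightarrow> real"
  assumes "\<And>i. i \<in> I \<Longrightarrow> 0 \<le> g i" "\<And>i. i \<in> I \<Longrightarrow> 0 \<le> w i"
    and "\<And>i. i \<in> I \<Longrightarrow> (t i)\<^sup>2 \<le> g i * w i"
  shows "(\<Sum>i\<in>I. \<bar>t i\<bar>)\<^sup>2 \<le> (\<Sum>i\<in>I. g i) * (\<Sum>i\<in>I. w i)"
proof -
  have "\<bar>t i\<bar> \<le> sqrt (g i) * sqrt (w i)" if "i \<in> I" for i
    using assms(3)[OF that] real_le_rsqrt[of "\<bar>t i\<bar>" "g i * w i"] by (simp add: real_sqrt_mult)
  then have "(\<Sum>i\<in>I. \<bar>t i\<bar>)\<^sup>2 \<le> (\<Sum>i\<in>I. sqrt (g i) * sqrt (w i))\<^sup>2"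
    by (intro power_mono sum_mono sum_nonneg) auto
  also have "\<dots> \<le> (\<Sum>i\<in>I. (sqrt (g i))\<^sup>2) * (\<Sum>i\<in>I. (sqrt (w i))\<^sup>2)"
    by (rule Cauchy_Schwarz_ineq_sum)
  also have "\<dots> = (\<Sum>i\<in>I. g i) * (\<Sum>i\<in>I. w i)"
    using assms(1,2) by simp
  finally show ?thesis .
qed

text \<open>For independent \<open>S\<^sub>1\<close>, \<open>S\<^sub>2\<close> with distributions \<open>f\<^sub>1\<close>, \<open>f\<^sub>2\<close> and scores \<open>Z\<^sub>i\<close>, read \<open>v\<^sub>i(n)\<close> as
  \<open>E[Z\<^sub>i; S\<^sub>i = n]\<close> and \<open>w\<^sub>i(n)\<close> as a bound for \<open>E[Z\<^sub>i\<^sup>2; S\<^sub>i = n]\<close>; the two products below are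
  the corresponding quantities for \<open>Z\<^sub>1 + Z\<^sub>2\<close> and \<open>S\<^sub>1 + S\<^sub>2\<close>.\<close>
lemma score_mult:
  fixes f1 f2 v1 v2 w1 w2 :: "real fps"
  assumes f: "\<And>n. 0 \<le> fps_nth f1 n" "\<And>n. 0 \<le> fps_nth f2 n"
    and w: "\<And>n. 0 \<le> fps_nth w1 n" "\<And>n. 0 \<le> fps_nth w2 n"
    and v: "\<And>n. (fps_nth v1 n)\<^sup>2 \<le> fps_nth f1 n * fps_nth w1 n"
      "\<And>n. (fps_nth v2 n)\<^sup>2 \<le> fps_nth f2 n * fps_nth w2 n"
  defines "w \<equiv> w1 * f2 + f1 * w2 + fps_const 2 * (v1 * v2)"
  shows "0 \<le> fps_nth w n"
    and "(fps_nth (v1 * f2 + f1 * v2) n)\<^sup>2 \<le> fps_nth (f1 * f2) n * fps_nth w n"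
proof -
  define t where "t i = fps_nth v1 i * fps_nth f2 (n - i) + fps_nth f1 i * fps_nth v2 (n - i)" for i
  define g where "g i = fps_nth f1 i * fps_nth f2 (n - i)" for i
  define u where "u i = fps_nth w1 i * fps_nth f2 (n - i) + fps_nth f1 i * fps_nth w2 (n - i)
    + 2 * (fps_nth v1 i * fps_nth v2 (n - i))" for i
  have g: "0 \<le> g i" for i using f by (simp add: g_def)
  \<comment> \<open>The mixed term is at most \<open>2 sqrt (x y) \<le> x + y\<close> in absolute
    value.\<close>
  have u: "0 \<le> u i" for i
  proof -
    define x where "x = fps_nth w1 i * fps_nth f2 (n - i)"
    define y where "y = fps_nth f1 i * fps_nth w2 (n - i)"
    have xy: "0 \<le> x" "0 \<le> y" using f w by (simp_all add: x_def y_def)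
    have "(2 * (fps_nth v1 i * fps_nth v2 (n - i)))\<^sup>2 \<le> 4 * (x * y)"
      using mult_mono[OF v(1)[of i] v(2)[of "n - i"]] f w
      by (simp add: power_mult_distrib x_def y_def mult_ac)
    also have "\<dots> \<le> (x + y)\<^sup>2"
      using zero_le_power2[of "x - y"] by (simp add: power2_eq_square algebra_simps)
    finally have "\<bar>2 * (fps_nth v1 i * fps_nth v2 (n - i))\<bar> \<le> \<bar>x + y\<bar>"
      by (simp only: abs_le_square_iff)
    then show ?thesis using xy by (simp add: u_def x_def y_def)
  qed
  \<comment> \<open>The mixed terms of \<open>(t i)\<^sup>2\<close> and \<open>g i * u i\<close>
    agree, and the two squares are bounded by the hypotheses on \<open>v1\<close> and
    \<open>v2\<close>.\<close>
  have t: "(t i)\<^sup>2 \<le> g i * u i" for i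
  proof -
    have "(fps_nth v1 i)\<^sup>2 * (fps_nth f2 (n - i))\<^sup>2 \<le> fps_nth f1 i * fps_nth w1 i * (fps_nth f2 (n - i))\<^sup>2"
      by (intro mult_right_mono v) auto
    moreover have "(fps_nth f1 i)\<^sup>2 * (fps_nth v2 (n - i))\<^sup>2 \<le> (fps_nth f1 i)\<^sup>2 * (fps_nth f2 (n - i) * fps_nth w2 (n - i))"
      by (intro mult_left_mono v) auto
    ultimately show ?thesis
      by (simp add: t_def g_def u_def power2_eq_square algebra_simps)
  qed
  have w_nth: "fps_nth w n = (\<Sum>i=0..n. u i)"
    by (simp add: w_def u_def fps_mult_nth[of w1 f2] fps_mult_nth[of f1 w2] fps_mult_nth[of v1 v2]
        sum.distrib sum_distrib_left)
  then show "0 \<le> fps_nth w n" using u by (simp add: sum_nonneg)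
  have "(fps_nth (v1 * f2 + f1 * v2) n)\<^sup>2 = (\<Sum>i=0..n. t i)\<^sup>2"
    by (simp add: t_def fps_mult_nth sum.distrib)
  also have "\<dots> \<le> (\<Sum>i=0..n. \<bar>t i\<bar>)\<^sup>2"
    by (intro abs_le_square_iff[THEN iffD1]) (simp add: sum_abs)
  also have "\<dots> \<le> (\<Sum>i=0..n. g i) * (\<Sum>i=0..n. u i)"
    by (intro sum_squared_le_of_squares_le g u t)
  finally show "(fps_nth (v1 * f2 + f1 * v2) n)\<^sup>2 \<le> fps_nth (f1 * f2) n * fps_nth w n"
    by (simp add: w_nth g_def fps_mult_nth)
qed

text \<open>Up to sign, coefficient \<open>n\<close> is \<open>E[Z; S = n]\<close> for the score
  \<open>Z\<close>; the factor \<open>fps_X\<close> shifts the defect so that its index matches the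
  value of the sum.\<close>

definition fps_score :: "real fps \<Rightarrow> real fps \<Rightarrow> real fps" where
  "fps_score \<theta> f = fps_X * (fps_deriv f - \<theta> * f)"

text \<open>The product rule for \<open>z d/dz\<close>: scores of independent summands add.\<close>

lemma fps_score_mult: "fps_score (\<theta>1 + \<theta>2) (f1 * f2) = fps_score \<theta>1 f1 * f2 + f1 * fps_score \<theta>2 f2"
  by (simp add: fps_score_def algebra_simps)

text \<open>The scores are centred, so the mixed term in \<open>score_mult\<close> has total 0 and
  the second-moment bounds add up like variances.\<close>

lemma score_prod:
  fixes f \<theta> w :: "'i \<Rightarrow> real fps"
  assumes "finite I"
    and "\<And>i n. i \<in> I \<Longrightarrow> 0 \<le> fps_nth (f i) n"
    and "\<And>i. i \<in> I \<Longrightarrow> fps_l1 (f i)" and "\<And>i. i \<in> I \<Longrightarrow> fps_total (f i) = 1"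
    and "\<And>i. i \<in> I \<Longrightarrow> fps_l1 (fps_score (\<theta> i) (f i))"
    and "\<And>i. i \<in> I \<Longrightarrow> fps_total (fps_score (\<theta> i) (f i)) = 0"
    and "\<And>i. i \<in> I \<Longrightarrow> fps_l1 (w i)" and "\<And>i n. i \<in> I \<Longrightarrow> 0 \<le> fps_nth (w i) n"
    and "\<And>i n. i \<in> I \<Longrightarrow> (fps_nth (fps_score (\<theta> i) (f i)) n)\<^sup>2 \<le> fps_nth (f i) n * fps_nth (w i) n"
  defines "F \<equiv> \<lambda>I. \<Prod>i\<in>I. f i" and "V \<equiv> \<lambda>I. fps_score (\<Sum>i\<in>I. \<theta> i) (\<Prod>i\<in>I. f i)"
  shows "(\<forall>n. 0 \<le> fps_nth (F I) n) \<and> fps_l1 (F I) \<and> fps_total (F I) = 1 \<and>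
    fps_l1 (V I) \<and> fps_total (V I) = 0 \<and>
    (\<exists>W. fps_l1 W \<and> (\<forall>n. 0 \<le> fps_nth W n) \<and> fps_total W = (\<Sum>i\<in>I. fps_total (w i)) \<and>
      (\<forall>n. (fps_nth (V I) n)\<^sup>2 \<le> fps_nth (F I) n * fps_nth W n))"
  using assms(1-9)
proof (induction I rule: finite_induct)
  case empty
  show ?case
    by (auto simp: F_def V_def fps_score_def intro!: exI[of _ 0])
next
  case (insert i I)
  have "(\<forall>n. 0 \<le> fps_nth (F I) n) \<and> fps_l1 (F I) \<and> fps_total (F I) = 1 \<and>
    fps_l1 (V I) \<and> fps_total (V I) = 0 \<and>
    (\<exists>W. fps_l1 W \<and> (\<forall>n. 0 \<le> fps_nth W n) \<and> fps_total W = (\<Sum>i\<in>I. fps_total (w i)) \<and>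
      (\<forall>n. (fps_nth (V I) n)\<^sup>2 \<le> fps_nth (F I) n * fps_nth W n))"
    by (rule insert.IH) (use insert.prems in auto)
  then obtain W where F: "\<And>n. 0 \<le> fps_nth (F I) n" "fps_l1 (F I)" "fps_total (F I) = 1"
    and V: "fps_l1 (V I)" "fps_total (V I) = 0"
    and W: "fps_l1 W" "\<And>n. 0 \<le> fps_nth W n" "fps_total W = (\<Sum>i\<in>I. fps_total (w i))"
    and VW: "\<And>n. (fps_nth (V I) n)\<^sup>2 \<le> fps_nth (F I) n * fps_nth W n"
    by blast
  let ?v = "fps_score (\<theta> i) (f i)"
  have F': "F (insert i I) = f i * F I" using insert.hyps by (simp add: F_def)
  have V': "V (insert i I) = ?v * F I + f i * V I"
    using insert.hyps by (simp add: V_def F_def fps_score_mult)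
  note i = insert.prems[of i, simplified]
  define W' where "W' = w i * F I + f i * W + fps_const 2 * (?v * V I)"
  have "fps_l1 (f i * F I)" "fps_total (f i * F I) = 1"
    using i F by (auto simp: fps_total_mult)
  moreover have "fps_l1 (V (insert i I))" "fps_total (V (insert i I)) = 0"
    unfolding V' using i F V
    by (auto simp: fps_total_add fps_total_mult fps_l1_add fps_l1_mult)
  moreover have "fps_l1 W'" "fps_total W' = (\<Sum>i\<in>insert i I. fps_total (w i))"
    unfolding W'_def using i F V W insert.hyps
    by (auto simp: fps_total_add fps_total_mult fps_l1_add fps_l1_mult)
  moreover have "0 \<le> fps_nth W' n"
    "(fps_nth (V (insert i I)) n)\<^sup>2 \<le> fps_nth (F (insert i I)) n * fps_nth W' n" for n
    unfolding V' F' W'_def by (rule score_mult; use i F W VW in blast)+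
  moreover have "0 \<le> fps_nth (f i * F I) n" for n
    using i F by (intro fps_mult_nth_nonneg) auto
  ultimately show ?case unfolding F' by blast
qed

text \<open>Cauchy-Schwarz over the values of the sum, against the probability law
  \<open>\<Prod>i\<in>I. f i\<close> of total 1.\<close>

lemma l1_norm_score_prod:
  fixes f \<theta> w :: "'i \<Rightarrow> real fps"
  assumes "finite I"
    and "\<And>i n. i \<in> I \<Longrightarrow> 0 \<le> fps_nth (f i) n"
    and "\<And>i. i \<in> I \<Longrightarrow> fps_l1 (f i)" and "\<And>i. i \<in> I \<Longrightarrow> fps_total (f i) = 1"
    and "\<And>i. i \<in> I \<Longrightarrow> fps_l1 (fps_score (\<theta> i) (f i))"
    and "\<And>i. i \<in> I \<Longrightarrow> fps_total (fps_score (\<theta> i) (f i)) = 0"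
    and "\<And>i. i \<in> I \<Longrightarrow> fps_l1 (w i)" and "\<And>i n. i \<in> I \<Longrightarrow> 0 \<le> fps_nth (w i) n"
    and "\<And>i n. i \<in> I \<Longrightarrow> (fps_nth (fps_score (\<theta> i) (f i)) n)\<^sup>2 \<le> fps_nth (f i) n * fps_nth (w i) n"
  defines "\<rho> \<equiv> fps_deriv (\<Prod>i\<in>I. f i) - (\<Sum>i\<in>I. \<theta> i) * (\<Prod>i\<in>I. f i)"
  shows "fps_l1 (\<Prod>i\<in>I. f i)" "fps_total (\<Prod>i\<in>I. f i) = 1" "fps_l1 \<rho>"
    "l1_norm \<rho> \<le> sqrt (\<Sum>i\<in>I. fps_total (w i))"
proof -
  let ?F = "\<Prod>i\<in>I. f i" and ?V = "fps_score (\<Sum>i\<in>I. \<theta> i) (\<Prod>i\<in>I. f i)"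
  from score_prod[of I f \<theta> w, OF assms(1-9)] obtain W
    where F: "\<And>n. 0 \<le> fps_nth ?F n" "fps_l1 ?F" "fps_total ?F = 1"
    and W: "fps_l1 W" "\<And>n. 0 \<le> fps_nth W n" "fps_total W = (\<Sum>i\<in>I. fps_total (w i))"
    and VW: "\<And>n. (fps_nth ?V n)\<^sup>2 \<le> fps_nth ?F n * fps_nth W n"
    by blast
  show "fps_l1 ?F" "fps_total ?F = 1" by (fact F)+
  have le: "(\<Sum>n<N. \<bar>fps_nth \<rho> n\<bar>) \<le> sqrt (\<Sum>i\<in>I. fps_total (w i))" for N
  proof (rule real_le_rsqrt)
    \<comment> \<open>Coefficient \<open>n\<close> of the defect is coefficient \<open>n + 1\<close>
      of the score.\<close>
    have "(\<Sum>n<N. \<bar>fps_nth \<rho> n\<bar>) = (\<Sum>n<N. \<bar>fps_nth ?V (Suc n)\<bar>)"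
      by (simp add: fps_score_def \<rho>_def)
    then have "(\<Sum>n<N. \<bar>fps_nth \<rho> n\<bar>)\<^sup>2 \<le> (\<Sum>n<N. fps_nth ?F (Suc n)) * (\<Sum>n<N. fps_nth W (Suc n))"
      using sum_squared_le_of_squares_le[of "{..<N}" "\<lambda>n. fps_nth ?F (Suc n)" "\<lambda>n. fps_nth W (Suc n)"
          "\<lambda>n. fps_nth ?V (Suc n)"] F W VW by simp
    also have "\<dots> \<le> fps_total ?F * fps_total W"
    proof (rule mult_mono)
      have le: "(\<Sum>n<N. fps_nth g (Suc n)) \<le> fps_total g"
        if "fps_l1 g" "\<And>n. 0 \<le> fps_nth g n" for g
      proof -
        have "(\<Sum>n<N. fps_nth g (Suc n)) = (\<Sum>n\<in>Suc ` {..<N}. fps_nth g n)"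
          by (simp add: sum.reindex)
        also have "\<dots> \<le> fps_total g"
          unfolding fps_total_def using that fps_l1_summable by (intro sum_le_suminf) auto
        finally show ?thesis .
      qed
      show "(\<Sum>n<N. fps_nth ?F (Suc n)) \<le> fps_total ?F" by (rule le[OF F(2,1)])
      show "(\<Sum>n<N. fps_nth W (Suc n)) \<le> fps_total W" by (rule le[OF W(1,2)])
      show "0 \<le> fps_total ?F" "0 \<le> (\<Sum>n<N. fps_nth W (Suc n))"
        using F W by (auto intro!: sum_nonneg)
    qed
    finally show "(\<Sum>n<N. \<bar>fps_nth \<rho> n\<bar>)\<^sup>2 \<le> (\<Sum>i\<in>I. fps_total (w i))"
      using F W by simp
  qed
  show "fps_l1 \<rho>" "l1_norm \<rho> \<le> sqrt (\<Sum>i\<in>I. fps_total (w i))"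
    using fps_l1_bounded[OF le] by auto
qed

section \<open>Generating functions of distributions\<close>

definition fps_of_pmf :: "nat pmf \<Rightarrow> real fps" where
  "fps_of_pmf P = Abs_fps (pmf P)"

lemma fps_of_pmf_nth [simp]: "fps_nth (fps_of_pmf P) n = pmf P n"
  by (simp add: fps_of_pmf_def)

lemma pmf_nat_sums: "(\<lambda>n. pmf P n) sums (1 :: real)" for P :: "nat pmf"
proof -
  have "(\<lambda>n. measure P {n}) sums measure P (\<Union>n. {n})"
    by (intro measure_pmf.finite_measure_UNION) (auto simp: disjoint_family_on_def)
  then show ?thesis
    by (simp add: measure_pmf_single)
qed

lemma fps_l1_pmf: "fps_l1 (fps_of_pmf P)"
  and fps_total_pmf: "fps_total (fps_of_pmf P) = 1"
  using pmf_nat_sums[of P] by (auto simp: fps_l1_def fps_total_def sums_iff)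

lemma fps_of_pmf_add:
  "fps_of_pmf (bind_pmf P (\<lambda>x. map_pmf (\<lambda>y. x + y) Q)) = fps_of_pmf P * fps_of_pmf Q"
proof (rule fps_ext)
  fix n
  have s: "pmf (map_pmf (\<lambda>y. x + y) Q) n = (if x \<le> n then pmf Q (n - x) else 0)" for x
  proof (cases "x \<le> n")
    case True
    then have "pmf (map_pmf (\<lambda>y. x + y) Q) n = pmf (map_pmf (\<lambda>y. x + y) Q) (x + (n - x))" by simp
    also have "\<dots> = pmf Q (n - x)" by (rule pmf_map_inj') (simp add: inj_on_def)
    finally show ?thesis using True by simp
  qed (auto simp: pmf_eq_0_set_pmf)
  have "pmf (bind_pmf P (\<lambda>x. map_pmf (\<lambda>y. x + y) Q)) n =
      measure_pmf.expectation P (\<lambda>x. if x \<le> n then pmf Q (n - x) else 0)"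
    by (simp add: pmf_bind s)
  also have "\<dots> = (\<Sum>x\<in>{0..n}. pmf P x * (if x \<le> n then pmf Q (n - x) else 0))"
    by (subst integral_measure_pmf[of "{0..n}"]) (auto split: if_splits)
  finally show "fps_nth (fps_of_pmf (bind_pmf P (\<lambda>x. map_pmf (\<lambda>y. x + y) Q))) n =
      fps_nth (fps_of_pmf P * fps_of_pmf Q) n"
    by (simp add: fps_mult_nth)
qed

lemma fps_of_pmf_conv: "fps_of_pmf (conv_pmf P Q) = fps_of_pmf P * fps_of_pmf Q"
proof -
  have "conv_pmf P Q = bind_pmf P (\<lambda>x. map_pmf (\<lambda>y. x + y) Q)"
    by (simp add: conv_pmf_def pair_pmf_def map_bind_pmf map_pmf_def bind_assoc_pmf bind_return_pmf)
  then show ?thesis by (simp add: fps_of_pmf_add)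
qed

lemma fps_of_pmf_sum_list_replicate:
  "fps_of_pmf (map_pmf sum_list (replicate_pmf z Q)) = fps_of_pmf Q ^ z"
proof (induction z)
  case 0
  show ?case by (rule fps_ext) (simp add: indicator_def)
next
  case (Suc z)
  have "map_pmf sum_list (replicate_pmf (Suc z) Q) =
      bind_pmf Q (\<lambda>x. map_pmf (\<lambda>y. x + y) (map_pmf sum_list (replicate_pmf z Q)))"
    by (simp add: map_bind_pmf map_pmf_def bind_assoc_pmf bind_return_pmf)
  then show ?case by (simp add: fps_of_pmf_add Suc)
qed

text \<open>Conditioning on the number \<open>z\<close> of summands gives a Poisson mixture of
  powers. As \<open>Q\<close> puts no mass on 0, only \<open>z \<le> n\<close> contribute to
  coefficient \<open>n\<close>.\<close>

lemma fps_of_compound_poisson: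
  assumes "lam > 0" and Q0: "pmf Q 0 = 0"
  shows "fps_of_pmf (compound_poisson lam Q) = poisson_fps lam oo fps_of_pmf Q"
proof (rule fps_ext)
  fix n
  have z: "fps_nth (fps_of_pmf Q ^ z) n = 0" if "z > n" for z
    using startsby_zero_power_prefix[of "fps_of_pmf Q" z] that Q0 by auto
  have "pmf (compound_poisson lam Q) n =
      measure_pmf.expectation (poisson_pmf lam) (\<lambda>z. fps_nth (fps_of_pmf Q ^ z) n)"
    by (simp add: compound_poisson_def pmf_bind flip: fps_of_pmf_sum_list_replicate)
  also have "\<dots> = (\<Sum>z\<in>{0..n}. pmf (poisson_pmf lam) z * fps_nth (fps_of_pmf Q ^ z) n)"
    using z by (subst integral_measure_pmf[of "{0..n}"]) (auto simp: not_le intro: ccontr)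
  finally show "fps_nth (fps_of_pmf (compound_poisson lam Q)) n =
      fps_nth (poisson_fps lam oo fps_of_pmf Q) n"
    using assms by (simp add: fps_compose_nth poisson_fps_nth mult_ac)
qed

lemma deriv_fps_of_compound_poisson:
  assumes "lam > 0" and "pmf Q 0 = 0"
  shows "fps_deriv (fps_of_pmf (compound_poisson lam Q)) =
    fps_const lam * fps_deriv (fps_of_pmf Q) * fps_of_pmf (compound_poisson lam Q)"
  unfolding fps_of_compound_poisson[OF assms]
  using assms(2)
  by (simp add: fps_compose_deriv deriv_poisson_fps fps_compose_mult_distrib mult_ac)

lemma pmf_compound_poisson_0:
  assumes "lam > 0" and "pmf Q 0 = 0"
  shows "pmf (compound_poisson lam Q) 0 = exp (- lam)"
  using arg_cong[OF fps_of_compound_poisson[OF assms], of "\<lambda>f. fps_nth f 0"]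
  by (simp add: poisson_fps_nth)

text \<open>The total of the derivative is the mean.\<close>

lemma fps_l1_deriv_pmf:
  assumes "integrable (measure_pmf Q) real"
  shows "fps_l1 (fps_deriv (fps_of_pmf Q))"
proof -
  have "integrable (count_space UNIV) (\<lambda>n. pmf Q n * real n)"
    using assms unfolding measure_pmf_eq_density by (subst (asm) integrable_density) auto
  then have "summable (\<lambda>n. norm (pmf Q n * real n))"
    by (simp only: integrable_count_space_nat_iff)
  then have "summable (\<lambda>n. pmf Q (Suc n) * real (Suc n))"
    by (subst summable_Suc_iff) simp
  then show ?thesis
    by (simp add: fps_l1_def mult_ac abs_mult)
qed

lemma (in prob_space) indep_vars_fps_sum:
  fixes Y :: "'i \<Rightarrow> 'a \<Rightarrow> nat"
  assumes "finite I" "indep_vars (\<lambda>_. count_space UNIV) Y I"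
  shows "Abs_fps (\<lambda>n. prob {\<omega>\<in>space M. (\<Sum>i\<in>I. Y i \<omega>) = n}) =
    (\<Prod>i\<in>I. Abs_fps (\<lambda>n. prob {\<omega>\<in>space M. Y i \<omega> = n}))"
  using assms
proof (induction I rule: finite_induct)
  case empty
  show ?case by (rule fps_ext) (auto simp: prob_space)
next
  case (insert i I)
  let ?S = "\<lambda>\<omega>. \<Sum>i\<in>I. Y i \<omega>"
  have ind: "indep_vars (\<lambda>_. count_space UNIV) Y I"
    using insert.prems by (rule indep_vars_subset) auto
  have rv: "Y j \<in> measurable M (count_space UNIV)" if "j \<in> insert i I" for j
    using insert.prems that by (auto simp: indep_vars_def)
  have "indep_var (count_space UNIV) ((\<lambda>f. f i) \<circ> (\<lambda>\<omega>. restrict (\<lambda>i. Y i \<omega>) {i}))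
      (count_space UNIV) ((\<lambda>f. \<Sum>i\<in>I. f i) \<circ> (\<lambda>\<omega>. restrict (\<lambda>i. Y i \<omega>) I))"
    using insert.hyps
    by (intro indep_var_compose[OF indep_var_restrict[OF insert.prems]]) auto
  moreover have "(\<lambda>f. f i) \<circ> (\<lambda>\<omega>. restrict (\<lambda>i. Y i \<omega>) {i}) = Y i" by auto
  moreover have "(\<lambda>f. \<Sum>i\<in>I. f i) \<circ> (\<lambda>\<omega>. restrict (\<lambda>i. Y i \<omega>) I) = ?S"
    by (auto cong: rev_conj_cong)
  ultimately have indep: "indep_var (count_space UNIV) (Y i) (count_space UNIV) ?S" by simp
  have S_rv: "?S \<in> measurable M (count_space UNIV)"
    using indep by (rule indep_var_rv2)
  show ?case
  proof (rule fps_ext)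
    fix n
    have "prob {\<omega>\<in>space M. (\<Sum>i\<in>insert i I. Y i \<omega>) = n} =
        prob (\<Union>k\<in>{0..n}. {\<omega>\<in>space M. Y i \<omega> = k} \<inter> {\<omega>\<in>space M. ?S \<omega> = n - k})"
      using insert.hyps by (intro arg_cong[where f = prob]) auto
    also have "\<dots> = (\<Sum>k=0..n. prob ({\<omega>\<in>space M. Y i \<omega> = k} \<inter> {\<omega>\<in>space M. ?S \<omega> = n - k}))"
      using rv[of i] S_rv by (intro finite_measure_finite_Union) (auto simp: disjoint_family_on_def)
    also have "\<dots> = (\<Sum>k=0..n. prob {\<omega>\<in>space M. Y i \<omega> = k} * prob {\<omega>\<in>space M. ?S \<omega> = n - k})"
    proof (rule sum.cong)
      fix k
      have "prob ((\<lambda>\<omega>. (Y i \<omega>, ?S \<omega>)) -` ({k} \<times> {n - k}) \<inter> space M) =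
          prob (Y i -` {k} \<inter> space M) * prob (?S -` {n - k} \<inter> space M)"
        by (rule indep_varD[OF indep]) auto
      moreover have "(\<lambda>\<omega>. (Y i \<omega>, ?S \<omega>)) -` ({k} \<times> {n - k}) \<inter> space M =
          {\<omega>\<in>space M. Y i \<omega> = k} \<inter> {\<omega>\<in>space M. ?S \<omega> = n - k}" by auto
      moreover have "Y i -` {k} \<inter> space M = {\<omega>\<in>space M. Y i \<omega> = k}" by auto
      moreover have "?S -` {n - k} \<inter> space M = {\<omega>\<in>space M. ?S \<omega> = n - k}" by auto
      ultimately show "prob ({\<omega>\<in>space M. Y i \<omega> = k} \<inter> {\<omega>\<in>space M. ?S \<omega> = n - k}) =
          prob {\<omega>\<in>space M. Y i \<omega> = k} * prob {\<omega>\<in>space M. ?S \<omega> = n - k}" by simp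
    qed simp
    finally show "fps_nth (Abs_fps (\<lambda>n. prob {\<omega>\<in>space M. (\<Sum>i\<in>insert i I. Y i \<omega>) = n})) n =
        fps_nth (\<Prod>i\<in>insert i I. Abs_fps (\<lambda>n. prob {\<omega>\<in>space M. Y i \<omega> = n})) n"
      using insert.hyps by (simp add: fps_mult_nth flip: insert.IH[OF ind])
  qed
qed

lemma (in prob_space) fps_bernoulli_mult:
  fixes X B :: "'a \<Rightarrow> nat"
  assumes indep: "indep_var (count_space UNIV) B (count_space UNIV) X"
    and X: "distr M (count_space UNIV) X = measure_pmf Q"
    and B: "distr M (count_space UNIV) B = measure_pmf (map_pmf of_bool (bernoulli_pmf p))"
    and p: "0 \<le> p" "p \<le> 1" and Q0: "pmf Q 0 = 0"
  shows "Abs_fps (\<lambda>n. prob {\<omega>\<in>space M. B \<omega> * X \<omega> = n}) = fps_const (1 - p) + fps_const p * fps_of_pmf Q"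
proof (rule fps_ext)
  fix n
  have rv: "B \<in> measurable M (count_space UNIV)" "X \<in> measurable M (count_space UNIV)"
    using indep indep_var_rv1 indep_var_rv2 by blast+
  have BX: "prob {\<omega>\<in>space M. B \<omega> \<in> A \<and> X \<omega> \<in> C} =
      measure (measure_pmf (map_pmf of_bool (bernoulli_pmf p))) A * measure (measure_pmf Q) C" for A C :: "nat set"
  proof -
    have "prob ((\<lambda>\<omega>. (B \<omega>, X \<omega>)) -` (A \<times> C) \<inter> space M) =
        prob (B -` A \<inter> space M) * prob (X -` C \<inter> space M)"
      by (rule indep_varD[OF indep]) auto
    moreover have "(\<lambda>\<omega>. (B \<omega>, X \<omega>)) -` (A \<times> C) \<inter> space M = {\<omega>\<in>space M. B \<omega> \<in> A \<and> X \<omega> \<in> C}"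
      by auto
    moreover have "prob (B -` A \<inter> space M) = measure (measure_pmf (map_pmf of_bool (bernoulli_pmf p))) A"
      unfolding B[symmetric] using rv by (subst measure_distr) auto
    moreover have "prob (X -` C \<inter> space M) = measure (measure_pmf Q) C"
      unfolding X[symmetric] using rv by (subst measure_distr) auto
    ultimately show ?thesis by simp
  qed
  have B_vimage: "measure (measure_pmf (map_pmf of_bool (bernoulli_pmf p))) A =
      measure (measure_pmf (bernoulli_pmf p)) (of_bool -` A)" for A :: "nat set"
    by (simp add: measure_map_pmf)
  have B1: "measure (measure_pmf (map_pmf of_bool (bernoulli_pmf p))) {1::nat} = p"
  proof -
    have "of_bool -` {1::nat} = {True}" by (auto simp: of_bool_def split: if_splits)
    then show ?thesis unfolding B_vimage using p by (simp add: measure_pmf_single)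
  qed
  have B0: "measure (measure_pmf (map_pmf of_bool (bernoulli_pmf p))) {0::nat} = 1 - p"
  proof -
    have "of_bool -` {0::nat} = {False}" by (auto simp: of_bool_def split: if_splits)
    then show ?thesis unfolding B_vimage using p by (simp add: measure_pmf_single)
  qed
  have B2: "measure (measure_pmf (map_pmf of_bool (bernoulli_pmf p))) {2::nat..} = 0"
  proof -
    have "of_bool -` {2::nat..} = {}" by (auto simp: of_bool_def split: if_splits)
    then show ?thesis by (simp add: B_vimage)
  qed
  have ev: "{\<omega>\<in>space M. R (B \<omega>) (X \<omega>)} \<in> events" for R :: "nat \<Rightarrow> nat \<Rightarrow> bool"
  proof -
    have "(\<lambda>\<omega>. (B \<omega>, X \<omega>)) \<in> measurable M (count_space UNIV)"
      using measurable_Pair[OF rv] by (simp add: pair_measure_countable)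
    then have "(\<lambda>\<omega>. (B \<omega>, X \<omega>)) -` {(b, x). R b x} \<inter> space M \<in> events"
      by (rule measurable_sets) simp
    also have "(\<lambda>\<omega>. (B \<omega>, X \<omega>)) -` {(b, x). R b x} \<inter> space M = {\<omega>\<in>space M. R (B \<omega>) (X \<omega>)}"
      by auto
    finally show ?thesis .
  qed
  \<comment> \<open>\<open>B\<close> may take any natural value pointwise; its law makes
    \<open>B \<ge> 2\<close> a null event. Where \<open>B = 0\<close> the product is 0 whatever
    \<open>X\<close> is.\<close>
  have split: "prob {\<omega>\<in>space M. B \<omega> * X \<omega> = n} =
     prob {\<omega>\<in>space M. B \<omega> \<in> {0} \<and> X \<omega> \<in> (if n = 0 then UNIV else {})} +
     prob {\<omega>\<in>space M. B \<omega> \<in> {1} \<and> X \<omega> \<in> {n}} +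
     prob {\<omega>\<in>space M. B \<omega> \<in> {2..} \<and> B \<omega> * X \<omega> = n}"
  (is "_ = prob ?A + prob ?B + prob ?C")
  proof -
    have eq: "{\<omega>\<in>space M. B \<omega> * X \<omega> = n} = (?A \<union> ?B) \<union> ?C"
    proof -
      have "b = 0 \<or> b = 1 \<or> 2 \<le> b" for b :: nat by linarith
      then show ?thesis by (auto split: if_splits)
    qed
    have A: "?A \<in> events" and B: "?B \<in> events" and C: "?C \<in> events" by (rule ev)+
    have "prob ((?A \<union> ?B) \<union> ?C) = prob (?A \<union> ?B) + prob ?C"
      by (rule finite_measure_Union[OF sets.Un[OF A B] C]) auto
    also have "prob (?A \<union> ?B) = prob ?A + prob ?B"
      by (rule finite_measure_Union[OF A B]) auto
    finally show ?thesis unfolding eq .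
  qed
  have "prob {\<omega>\<in>space M. B \<omega> \<in> {2..} \<and> B \<omega> * X \<omega> = n} \<le> prob {\<omega>\<in>space M. B \<omega> \<in> {2..} \<and> X \<omega> \<in> UNIV}"
    by (rule finite_measure_mono[OF _ ev[of "\<lambda>b x. b \<in> {2..} \<and> x \<in> UNIV"]]) auto
  also have "\<dots> = 0" unfolding BX B2 by simp
  finally have "prob {\<omega>\<in>space M. B \<omega> \<in> {2..} \<and> B \<omega> * X \<omega> = n} = 0"
    using measure_nonneg[of M] by (simp add: order_antisym)
  then show "fps_nth (Abs_fps (\<lambda>n. prob {\<omega>\<in>space M. B \<omega> * X \<omega> = n})) n =
      fps_nth (fps_const (1 - p) + fps_const p * fps_of_pmf Q) n"
    using Q0 unfolding fps_nth_Abs_fps split BX B0 B1 by (simp add: measure_pmf_single)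
qed

section \<open>The compound Poisson bound\<close>

text \<open>Positivity of the factor is recorded because \<open>0 * \<top> = 0\<close> in
  \<open>ennreal\<close>: it keeps the final bound infinite when the sum of squares
  diverges.\<close>

lemma compound_poisson_distance_le_stein_factor:
  fixes F :: "real fps" and lam :: real and Q :: "nat pmf"
  defines "\<rho> \<equiv> fps_deriv F - fps_const lam * fps_deriv (fps_of_pmf Q) * F"
  assumes lam: "0 < lam" and Q0: "pmf Q 0 = 0" and Q1: "0 < pmf Q 1"
    and l1_Q': "fps_l1 (fps_deriv (fps_of_pmf Q))"
    and F: "fps_l1 F" "fps_total F = 1" "fps_l1 \<rho>"
  shows "0 < stein_factor lam Q"
    and "(\<Sum>n<N. \<bar>fps_nth F n - pmf (compound_poisson lam Q) n\<bar>) \<le> 2 * l1_norm \<rho> * stein_factor lam Q"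
proof -
  let ?\<theta> = "fps_const lam * fps_deriv (fps_of_pmf Q)"
  interpret fps_compound_poisson ?\<theta> "fps_of_pmf (compound_poisson lam Q)"
  proof
    show "fps_l1 ?\<theta>" using l1_Q' by auto
  qed (use lam Q0 in \<open>auto simp: deriv_fps_of_compound_poisson pmf_compound_poisson_0
        fps_l1_pmf fps_total_pmf\<close>)
  let ?D = "\<Sum>n<N. \<bar>fps_nth F n - pmf (compound_poisson lam Q) n\<bar>"
  note \<rho> = F(3)[unfolded \<rho>_def]
  have n\<rho>: "0 \<le> l1_norm \<rho>" by (rule l1_norm_nonneg[OF F(3)])
  have "0 < stein_factor lam Q \<and> ?D \<le> 2 * l1_norm \<rho> * stein_factor lam Q"
  proof (cases "antimono_on {1..} (\<lambda>j. real j * pmf Q j)")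
    case True
    \<comment> \<open>Index shift: coefficient \<open>j - 1\<close> of \<open>?\<theta>\<close> is
      \<open>lam * j * pmf Q j\<close>.\<close>
    have anti: "fps_nth ?\<theta> n \<le> fps_nth ?\<theta> m" if "m \<le> n" for m n
      using monotone_onD[OF True, of "Suc m" "Suc n"] that lam by simp
    \<comment> \<open>\<open>c\<close> is \<open>1 / \<delta>\<close> and at the same time the
      difference of the first two coefficients of \<open>?\<theta>\<close>; \<open>c = 0\<close> is
      the case of infinite \<open>\<delta>\<close>.\<close>
    define c where "c = lam * (pmf Q 1 - 2 * pmf Q 2)"
    have stein_delta: "stein_delta lam Q = 1 / ereal c"
      unfolding stein_delta_def c_def ..
    have c_eq: "fps_nth ?\<theta> 0 - fps_nth ?\<theta> 1 = c"
      by (simp add: c_def algebra_simps numeral_2_eq_2)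
    have c: "0 \<le> c" using anti[of 0 1] c_eq by simp
    have D1: "?D \<le> 2 * l1_norm \<rho>"
      unfolding \<rho>_def using distance_le_antimono[OF F(1,2) \<rho> anti] by simp
    show ?thesis
    proof (cases "c \<le> 1")
      case c1: True
      have "1 \<le> stein_delta lam Q"
      proof (cases "c = 0")
        case True
        then show ?thesis
          by (simp add: stein_delta divide_ereal_def flip: zero_ereal_def)
      next
        case False
        then show ?thesis
          using c c1 by (simp add: stein_delta one_ereal_def)
      qed
      then show ?thesis using True D1 by (simp add: stein_factor_def)
    next
      case False
      then have c1: "c > 1" by simp
      have delta: "stein_delta lam Q = ereal (1 / c)"
        using c1 by (simp add: stein_delta one_ereal_def)
      have "?D \<le> 2 * l1_norm \<rho> / sqrt c"
        unfolding \<rho>_def c_eq[symmetric]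
        using distance_le_antimono_sqrt[OF F(1,2) \<rho> anti] c_eq c1 by simp
      also have "\<dots> = 2 * l1_norm \<rho> * sqrt (1 / c)"
        by (simp add: real_sqrt_divide)
      finally have D: "?D \<le> 2 * l1_norm \<rho> * sqrt (1 / c)" .
      have sq: "0 < sqrt (1 / c)" "sqrt (1 / c) < 1"
        using c1 by simp_all
      have "\<not> 1 \<le> stein_delta lam Q"
        unfolding delta one_ereal_def using c1 by simp
      then have H: "stein_factor lam Q = sqrt (1 / c) * (2 - sqrt (1 / c))"
        using True by (simp add: stein_factor_def delta Let_def)
      \<comment> \<open>The bound obtained is \<open>sqrt \<delta>\<close>, which is at most
        \<open>sqrt \<delta> (2 - sqrt \<delta>)\<close> because
        \<open>\<delta> < 1\<close>.\<close>
      have "sqrt (1 / c) * 1 \<le> sqrt (1 / c) * (2 - sqrt (1 / c))"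
        using sq by (intro mult_left_mono) auto
      then have le: "sqrt (1 / c) \<le> stein_factor lam Q" by (simp add: H)
      have "2 * l1_norm \<rho> * sqrt (1 / c) \<le> 2 * l1_norm \<rho> * stein_factor lam Q"
        using n\<rho> by (intro mult_left_mono le) simp
      then show ?thesis using less_le_trans[OF sq(1) le] D by linarith
    qed
  next
    case False
    have "min 1 (1 / ereal (lam * pmf Q 1)) = ereal (min 1 (1 / (lam * pmf Q 1)))"
      using lam Q1 by (simp add: one_ereal_def min_def)
    then have H: "stein_factor lam Q = exp lam * min 1 (1 / (lam * pmf Q 1))"
      unfolding stein_factor_def using False by (simp only: if_False real_of_ereal.simps)
    have "?D \<le> 2 * l1_norm \<rho> * (exp lam * min 1 (1 / (lam * pmf Q 1)))"
      using distance_le_exp[of lam "fps_of_pmf Q" F N] lam Q1 F fps_l1_pmf[of Q] fps_total_pmf[of Q]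
      by (simp add: \<rho>_def)
    then show ?thesis using H lam Q1 by simp
  qed
  then show "0 < stein_factor lam Q" "?D \<le> 2 * l1_norm \<rho> * stein_factor lam Q" by auto
qed

lemma summable_of_infsum_ennreal:
  fixes g :: "nat \<Rightarrow> real"
  assumes g: "\<And>n. 0 \<le> g n" and g0: "g 0 = 0"
    and fin: "(\<Sum>\<^sub>\<infinity>y\<in>{1..}. ennreal (g y)) \<noteq> \<top>"
  shows "summable g" and "(\<Sum>\<^sub>\<infinity>y\<in>{1..}. ennreal (g y)) = ennreal (\<Sum>n. g n)"
proof -
  have "(\<Sum>\<^sub>\<infinity>y\<in>{1..}. ennreal (g y)) = (\<Sum>\<^sub>\<infinity>y. ennreal (g y))"
  proof (rule infsum_cong_neutral)
    fix y :: nat assume "y \<in> UNIV - {1..}"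
    then have "y = 0" by auto
    then show "ennreal (g y) = 0" using g0 by simp
  qed auto
  also have "\<dots> = (\<Sum>y. ennreal (g y))"
    by (intro sums_unique has_sum_imp_sums has_sum_infsum nonneg_summable_on_complete) simp
  finally have eq: "(\<Sum>\<^sub>\<infinity>y\<in>{1..}. ennreal (g y)) = (\<Sum>y. ennreal (g y))" .
  show "summable g"
    using fin g unfolding eq by (intro summable_suminf_not_top) auto
  then show "(\<Sum>\<^sub>\<infinity>y\<in>{1..}. ennreal (g y)) = ennreal (\<Sum>n. g n)"
    unfolding eq using g by (intro suminf_ennreal2) auto
qed

text \<open>Since \<open>f' = p q'\<close>, the defect of one summand is
  \<open>p q' (1 - f) = p\<^sup>2 q' (1 - q)\<close>. Its total is 0 as \<open>q\<close> has total
  1.\<close>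

lemma score_bernoulli_mult:
  fixes p :: real and Q :: "nat pmf"
  defines "q \<equiv> fps_of_pmf Q" and "f \<equiv> fps_const (1 - p) + fps_const p * fps_of_pmf Q"
    and "g \<equiv> \<lambda>y. pmf Q y * (real y)\<^sup>2 * (pmf (conv_pmf Q Q) y / (2 * pmf Q y) - 1)\<^sup>2"
  assumes p: "0 \<le> p" "p \<le> 1" and Q: "set_pmf Q = {1..}" and l1_q': "fps_l1 (fps_deriv q)"
  shows "0 \<le> fps_nth f n" and "fps_l1 f" and "fps_total f = 1"
    and "fps_l1 (fps_score (fps_const p * fps_deriv q) f)"
    and "fps_total (fps_score (fps_const p * fps_deriv q) f) = 0"
    and "(fps_nth (fps_score (fps_const p * fps_deriv q) f) n)\<^sup>2 \<le> fps_nth f n * (p ^ 3 * g n)"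
proof -
  have q: "fps_l1 q" "fps_total q = 1"
    unfolding q_def by (rule fps_l1_pmf fps_total_pmf)+
  have f: "f = fps_const (1 - p) + fps_const p * q" by (simp add: f_def q_def)
  show f_nonneg: "0 \<le> fps_nth f n" for n using p by (simp add: f_def)
  show "fps_l1 f" unfolding f using q by auto
  show "fps_total f = 1" unfolding f using q by (simp add: fps_total_add fps_total_mult fps_l1_mult)
  have one_minus: "1 - f = fps_const p * (1 - q)"
    by (rule fps_ext) (simp add: f algebra_simps)
  have "fps_score (fps_const p * fps_deriv q) f = fps_X * (fps_const p * fps_deriv q * (1 - f))"
    by (simp add: fps_score_def f algebra_simps)
  then have score: "fps_score (fps_const p * fps_deriv q) f = fps_const (p\<^sup>2) * (fps_X * fps_deriv q * (1 - q))"
    unfolding one_minus power2_eq_square fps_const_mult[symmetric] by (simp only: mult_ac)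
  show "fps_l1 (fps_score (fps_const p * fps_deriv q) f)"
    unfolding score using q l1_q' by auto
  have "fps_total (1 - q) = 0" using q by (simp add: fps_total_diff)
  then show "fps_total (fps_score (fps_const p * fps_deriv q) f) = 0"
    unfolding score using q l1_q' by (simp add: fps_total_mult fps_l1_mult fps_l1_diff)
  show "(fps_nth (fps_score (fps_const p * fps_deriv q) f) n)\<^sup>2 \<le> fps_nth f n * (p ^ 3 * g n)" for n
  proof (cases "n = 0")
    case True
    then show ?thesis by (simp add: fps_score_def g_def)
  next
    case False
    then obtain m where m: "n = Suc m" by (cases n) auto
    have pos: "0 < pmf Q n" using False Q by (intro pmf_positive) auto
    have nth: "fps_nth (fps_X * fps_deriv h) n = real n * fps_nth h n" for h :: "real fps"
      by (simp add: m)
    define T where "T = fps_X * fps_deriv q * (1 - q)"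
    \<comment> \<open>The identity \<open>2 q q' = (q * q)'\<close> brings in the convolution
      square.\<close>
    have "fps_const 2 * T = fps_const 2 * (fps_X * fps_deriv q) - fps_X * fps_deriv (q * q)"
      by (simp add: T_def algebra_simps flip: numeral_fps_const)
    then have "fps_nth (fps_const 2 * T) n =
        fps_nth (fps_const 2 * (fps_X * fps_deriv q) - fps_X * fps_deriv (q * q)) n"
      by (rule arg_cong)
    also have "\<dots> = 2 * (real n * pmf Q n) - real n * pmf (conv_pmf Q Q) n"
      unfolding fps_sub_nth fps_mult_left_const_nth nth by (simp add: q_def flip: fps_of_pmf_conv)
    finally have "2 * fps_nth T n = 2 * (real n * pmf Q n) - real n * pmf (conv_pmf Q Q) n"
      by simp
    moreover have "2 * (real n * pmf Q n * (1 - pmf (conv_pmf Q Q) n / (2 * pmf Q n))) =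
        2 * (real n * pmf Q n) - real n * pmf (conv_pmf Q Q) n"
      using pos by (simp add: field_simps)
    ultimately have "fps_nth T n = real n * pmf Q n * (1 - pmf (conv_pmf Q Q) n / (2 * pmf Q n))"
      by linarith
    then have "fps_nth (fps_score (fps_const p * fps_deriv q) f) n =
        p\<^sup>2 * (real n * pmf Q n * (1 - pmf (conv_pmf Q Q) n / (2 * pmf Q n)))"
      unfolding score T_def[symmetric] fps_mult_left_const_nth by simp
    \<comment> \<open>One factor \<open>p * pmf Q n\<close> is coefficient \<open>n\<close> of
      \<open>f\<close>, as \<open>n > 0\<close>; the remaining \<open>p ^ 3\<close> goes to the
      variance term.\<close>
    then have "(fps_nth (fps_score (fps_const p * fps_deriv q) f) n)\<^sup>2 =
        (p * pmf Q n) * (p ^ 3 * (pmf Q n * (real n)\<^sup>2 * (1 - pmf (conv_pmf Q Q) n / (2 * pmf Q n))\<^sup>2))"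
      by (simp add: power2_eq_square power3_eq_cube)
    also have "\<dots> = fps_nth f n * (p ^ 3 * g n)"
      using m by (simp add: f_def g_def power2_commute)
    finally show ?thesis by simp
  qed
qed

theorem theorem1p4:
  fixes M :: "'a measure" and n :: nat and p :: "nat \<Rightarrow> real" and Q :: "nat \<Rightarrow> nat pmf"
    and X B :: "nat \<Rightarrow> 'a \<Rightarrow> nat" and lam :: real and Qbar :: "nat pmf"
  assumes "prob_space M"
    and "n \<ge> 1"
    and "\<And>i. i \<in> {1..n} \<Longrightarrow> 0 < p i \<and> p i < 1"
    and "\<And>i. i \<in> {1..n} \<Longrightarrow> set_pmf (Q i) = {1..}"
    and "\<And>i. i \<in> {1..n} \<Longrightarrow> integrable (measure_pmf (Q i)) real"
    and "prob_space.indep_vars M (\<lambda>_. count_space UNIV) (case_sum X B) ({1..n} <+> {1..n})"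
    and "\<And>i. i \<in> {1..n} \<Longrightarrow> distr M (count_space UNIV) (X i) = measure_pmf (Q i)"
    and "\<And>i. i \<in> {1..n} \<Longrightarrow>
           distr M (count_space UNIV) (B i) = measure_pmf (map_pmf of_bool (bernoulli_pmf (p i)))"
    and "lam = (\<Sum>i\<in>{1..n}. p i)"
    and "Qbar = mixture_pmf n p Q"
  shows "ennreal (tv_dist (distr M (count_space UNIV) (\<lambda>\<omega>. \<Sum>i\<in>{1..n}. B i \<omega> * X i \<omega>))
                          (measure_pmf (compound_poisson lam Qbar)))
         \<le> ennreal (stein_factor lam Qbar) *
           ennreal_sqrt (\<Sum>i\<in>{1..n}. ennreal (p i ^ 3) *
             (\<Sum>\<^sub>\<infinity>y\<in>{1..}. ennreal (pmf (Q i) y * (real y)\<^sup>2 *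
                (pmf (conv_pmf (Q i) (Q i)) y / (2 * pmf (Q i) y) - 1)\<^sup>2)))"
proof -
  note p = assms(3) and Q = assms(4) and mean = assms(5) and indep = assms(6)
    and X = assms(7) and B = assms(8) and lam = assms(9) and Qbar = assms(10)
  interpret prob_space M by (rule assms(1))
  define I where "I = {1..n}"
  have I: "finite I" "I \<noteq> {}" using \<open>n \<ge> 1\<close> by (auto simp: I_def)
  note in_I = I_def[symmetric]
  define g where "g i y = pmf (Q i) y * (real y)\<^sup>2 *
    (pmf (conv_pmf (Q i) (Q i)) y / (2 * pmf (Q i) y) - 1)\<^sup>2" for i y
  define f where "f i = fps_const (1 - p i) + fps_const (p i) * fps_of_pmf (Q i)" for i
  define \<theta> where "\<theta> i = fps_const (p i) * fps_deriv (fps_of_pmf (Q i))" for i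
  define F where "F = (\<Prod>i\<in>I. f i)"
  define S where "S \<omega> = (\<Sum>i\<in>I. B i \<omega> * X i \<omega>)" for \<omega>
  have Q0: "pmf (Q i) 0 = 0" if "i \<in> I" for i
    using Q[of i] that by (simp add: pmf_eq_0_set_pmf I_def)
  have lam_pos: "0 < lam" unfolding lam using p I by (intro sum_pos) (auto simp: I_def)
  have Qbar_pmf: "pmf Qbar y = (\<Sum>i\<in>I. p i / lam * pmf (Q i) y)" for y
    unfolding Qbar using pmf_mixture_pmf[of n p Q y] p lam_pos by (auto simp: lam I_def less_imp_le)
  have \<theta>_sum: "fps_const lam * fps_deriv (fps_of_pmf Qbar) = (\<Sum>i\<in>I. \<theta> i)"
    using lam_pos by (intro fps_ext)
      (simp add: \<theta>_def fps_sum_nth Qbar_pmf sum_distrib_left mult_ac)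
  have l1_Q': "fps_l1 (fps_deriv (fps_of_pmf (Q i)))" if "i \<in> I" for i
    using mean that by (intro fps_l1_deriv_pmf) (auto simp: I_def)

  \<comment> \<open>Independence and the generating function of the sum\<close>
  have "indep_vars (\<lambda>i. PiM {Inl i, Inr i} (\<lambda>_. count_space UNIV))
      (\<lambda>i \<omega>. restrict (\<lambda>j. case_sum X B j \<omega>) {Inl i, Inr i}) I"
    by (rule indep_vars_restrict[OF indep]) (auto simp: I_def disjoint_family_on_def)
  then have "indep_vars (\<lambda>_. count_space UNIV)
      (\<lambda>i \<omega>. (\<lambda>h. h (Inr i) * h (Inl i)) (restrict (\<lambda>j. case_sum X B j \<omega>) {Inl i, Inr i})) I"
    by (rule indep_vars_compose2) simp
  then have Y_indep: "indep_vars (\<lambda>_. count_space UNIV) (\<lambda>i \<omega>. B i \<omega> * X i \<omega>) I"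
    by simp
  have BX_indep: "indep_var (count_space UNIV) (B i) (count_space UNIV) (X i)" if "i \<in> I" for i
  proof -
    have "indep_var (count_space UNIV) ((\<lambda>h. h (Inr i)) \<circ> (\<lambda>\<omega>. restrict (\<lambda>j. case_sum X B j \<omega>) {Inr i}))
       (count_space UNIV) ((\<lambda>h. h (Inl i)) \<circ> (\<lambda>\<omega>. restrict (\<lambda>j. case_sum X B j \<omega>) {Inl i}))"
      using that by (intro indep_var_compose[OF indep_var_restrict[OF indep]]) (auto simp: I_def)
    then show ?thesis by (simp add: comp_def)
  qed
  have S_F: "measure (distr M (count_space UNIV) S) {k} = fps_nth F k" for k
  proof -
    have [measurable]: "(\<lambda>\<omega>. B i \<omega> * X i \<omega>) \<in> measurable M (count_space UNIV)" if "i \<in> I" for i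
      using Y_indep that by (auto simp: indep_vars_def)
    have "S \<in> measurable M (count_space UNIV)"
      unfolding S_def by measurable
    then have "measure (distr M (count_space UNIV) S) {k} = prob {\<omega>\<in>space M. S \<omega> = k}"
      by (subst measure_distr) (auto intro!: arg_cong[where f = prob])
    also have "\<dots> = fps_nth (Abs_fps (\<lambda>n. prob {\<omega>\<in>space M. (\<Sum>i\<in>I. B i \<omega> * X i \<omega>) = n})) k"
      by (simp add: S_def)
    also have "Abs_fps (\<lambda>n. prob {\<omega>\<in>space M. (\<Sum>i\<in>I. B i \<omega> * X i \<omega>) = n}) = F"
      unfolding indep_vars_fps_sum[OF I(1) Y_indep] F_def f_def
      using p X B Q0 BX_indep by (intro prod.cong refl fps_bernoulli_mult) (auto simp: I_def less_imp_le)
    finally show ?thesis .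
  qed

  \<comment> \<open>The averaged distribution and the individual scores\<close>
  have Qbar0: "pmf Qbar 0 = 0" using Q0 by (simp add: Qbar_pmf)
  have Qbar1: "0 < pmf Qbar 1"
    unfolding Qbar_pmf using p Q lam_pos I
    by (intro sum_pos mult_pos_pos divide_pos_pos pmf_positive) (auto simp: I_def)
  have "fps_deriv (fps_of_pmf Qbar) = (\<Sum>i\<in>I. fps_const (p i / lam) * fps_deriv (fps_of_pmf (Q i)))"
    by (rule fps_ext) (simp add: fps_sum_nth Qbar_pmf sum_distrib_left mult_ac)
  moreover have "fps_l1 (\<Sum>i\<in>I. fps_const (p i / lam) * fps_deriv (fps_of_pmf (Q i)))"
    using l1_Q' by (induction I rule: infinite_finite_induct) auto
  ultimately have l1_Qbar': "fps_l1 (fps_deriv (fps_of_pmf Qbar))" by simp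
  define E where "E = (\<Sum>i\<in>I. ennreal (p i ^ 3) * (\<Sum>\<^sub>\<infinity>y\<in>{1..}. ennreal (g i y)))"
  define H where "H = stein_factor lam Qbar"
  define \<rho> where "\<rho> = fps_deriv F - fps_const lam * fps_deriv (fps_of_pmf Qbar) * F"
  have score: "0 \<le> fps_nth (f i) k" "fps_l1 (f i)" "fps_total (f i) = 1" "fps_l1 (fps_score (\<theta> i) (f i))"
      "fps_total (fps_score (\<theta> i) (f i)) = 0"
      "(fps_nth (fps_score (\<theta> i) (f i)) k)\<^sup>2 \<le> fps_nth (f i) k * (p i ^ 3 * g i k)"
    if "i \<in> I" for i k
  proof -
    have "0 \<le> p i" "p i \<le> 1" "set_pmf (Q i) = {1..}"
      using p Q that by (auto simp: I_def less_imp_le)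
    note * = score_bernoulli_mult[OF this l1_Q'[OF that], folded f_def \<theta>_def g_def]
    show "0 \<le> fps_nth (f i) k" "fps_l1 (f i)" "fps_total (f i) = 1" "fps_l1 (fps_score (\<theta> i) (f i))"
      "fps_total (fps_score (\<theta> i) (f i)) = 0"
      "(fps_nth (fps_score (\<theta> i) (f i)) k)\<^sup>2 \<le> fps_nth (f i) k * (p i ^ 3 * g i k)"
      by (fact *)+
  qed

  \<comment> \<open>Total variation for infinite and finite right-hand side\<close>
  have "ennreal (tv_dist (distr M (count_space UNIV) S) (measure_pmf (compound_poisson lam Qbar)))
      \<le> ennreal H * ennreal_sqrt E"
  proof (cases "E = \<top>")
    case True
    \<comment> \<open>The factor does not depend on \<open>F\<close>, so the constant series 1, the
      law of the empty sum, serves as an instance.\<close>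
    have "0 < H"
      unfolding H_def using l1_Qbar'
      by (intro compound_poisson_distance_le_stein_factor(1)[where F = 1] lam_pos Qbar0 Qbar1) auto
    then show ?thesis using True by (simp add: ennreal_sqrt_def ennreal_mult_top)
  next
    case False
    have fin: "(\<Sum>\<^sub>\<infinity>y\<in>{1..}. ennreal (g i y)) \<noteq> \<top>" if "i \<in> I" for i
    proof
      assume "(\<Sum>\<^sub>\<infinity>y\<in>{1..}. ennreal (g i y)) = \<top>"
      then have "ennreal (p i ^ 3) * (\<Sum>\<^sub>\<infinity>y\<in>{1..}. ennreal (g i y)) = \<top>"
        using p that by (simp add: ennreal_mult_top I_def ennreal_eq_0_iff not_le)
      then show False using False that I by (auto simp: E_def)
    qed
    have g: "0 \<le> g i y" "g i 0 = 0" for i y by (simp_all add: g_def)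
    have g_summable: "summable (g i)" if "i \<in> I" for i
      using summable_of_infsum_ennreal(1)[of "g i"] fin that g by blast
    define w where "w i = Abs_fps (\<lambda>y. p i ^ 3 * g i y)" for i
    have w_nonneg: "0 \<le> fps_nth (w i) y" if "i \<in> I" for i y
      using p that g by (simp add: w_def I_def less_imp_le)
    have w_sums: "fps_nth (w i) sums (p i ^ 3 * (\<Sum>y. g i y))" if "i \<in> I" for i
      using sums_mult[OF summable_sums[OF g_summable[OF that]], of "p i ^ 3"]
      by (simp add: w_def sums_def)
    have l1_w: "fps_l1 (w i)" if "i \<in> I" for i
      using w_nonneg w_sums that by (intro fps_l1_nonneg_sumsI) auto
    have total_w: "0 \<le> fps_total (w i)" if "i \<in> I" for i
      using l1_norm_nonneg[OF l1_w[OF that]] w_nonneg[OF that] by (simp add: l1_norm_eq_total)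
    have E: "E = ennreal (\<Sum>i\<in>I. fps_total (w i))"
    proof -
      have "ennreal (p i ^ 3) * (\<Sum>\<^sub>\<infinity>y\<in>{1..}. ennreal (g i y)) = ennreal (fps_total (w i))"
        if "i \<in> I" for i
        using summable_of_infsum_ennreal(2)[of "g i"] fin that g p suminf_nonneg[OF g_summable[OF that]]
          fps_total_eqI[OF w_sums[OF that]]
        by (simp add: ennreal_mult I_def less_imp_le)
      then have "E = (\<Sum>i\<in>I. ennreal (fps_total (w i)))" by (simp add: E_def)
      also have "\<dots> = ennreal (\<Sum>i\<in>I. fps_total (w i))"
        by (rule sum_ennreal) (rule total_w)
      finally show ?thesis .
    qed
    have F: "fps_l1 F" "fps_total F = 1" and \<rho>: "fps_l1 \<rho>"
      "l1_norm \<rho> \<le> sqrt (\<Sum>i\<in>I. fps_total (w i))"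
      unfolding F_def \<rho>_def \<theta>_sum
      by (rule l1_norm_score_prod[where f = f and \<theta> = \<theta> and w = w]; use I score l1_w w_nonneg in \<open>simp add: w_def\<close>)+
    note stein = compound_poisson_distance_le_stein_factor[OF lam_pos Qbar0 Qbar1 l1_Qbar' F
        \<rho>(1)[unfolded \<rho>_def], folded \<rho>_def H_def]
    let ?d = "\<lambda>k. \<bar>fps_nth F k - pmf (compound_poisson lam Qbar) k\<bar>"
    have "summable ?d"
      using fps_l1_diff[OF F(1) fps_l1_pmf[of "compound_poisson lam Qbar"]] by (simp add: fps_l1_def)
    then have "(\<Sum>k. ?d k) \<le> 2 * l1_norm \<rho> * H"
      using stein(2) by (rule suminf_le_const)
    moreover have "tv_dist (distr M (count_space UNIV) S) (measure_pmf (compound_poisson lam Qbar)) =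
        1/2 * (\<Sum>k. ?d k)"
      by (simp add: tv_dist_def S_F measure_pmf_single)
    \<comment> \<open>The \<open>1/2\<close> of total variation cancels the 2 of the distance
      bound.\<close>
    ultimately have "tv_dist (distr M (count_space UNIV) S) (measure_pmf (compound_poisson lam Qbar)) \<le> H * l1_norm \<rho>"
      by (simp add: mult_ac)
    also have "\<dots> \<le> H * sqrt (\<Sum>i\<in>I. fps_total (w i))"
      using stein(1) \<rho>(2) by (intro mult_left_mono) auto
    finally have "ennreal (tv_dist (distr M (count_space UNIV) S) (measure_pmf (compound_poisson lam Qbar)))
        \<le> ennreal H * ennreal (sqrt (\<Sum>i\<in>I. fps_total (w i)))"
      using stein(1) by (simp add: ennreal_leI flip: ennreal_mult')
    also have "ennreal (sqrt (\<Sum>i\<in>I. fps_total (w i))) = ennreal_sqrt E"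
      using total_w by (simp add: ennreal_sqrt_def E sum_nonneg)
    finally show ?thesis .
  qed
  then show ?thesis
    unfolding H_def E_def S_def g_def I_def .
qed

end
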